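(* Let $\alpha_0,\alpha_1,\alpha_2,\alpha_3$ be complex parameters with $\alpha_0+\alpha_1+\alpha_2+\alpha_3=1$. Consider a polynomial Hamiltonian system $$\frac{dx}{dt}=\frac{\partial K}{\partial y},\quad \frac{dy}{dt}=-\frac{\partial K}{\partial x},\quad \frac{dz}{dt}=\frac{\partial K}{\partial w},\quad \frac{dw}{dt}=-\frac{\partial K}{\partial z},\quad \frac{dq}{dt}=\frac{\partial K}{\partial p},\quad \frac{dp}{dt}=-\frac{\partial K}{\partial q}$$ with Hamiltonian $K\in\mathbb{C}(t)[x,y,z,w,q,p]$. Assume that (A1) $\deg(K)=4$ with respect to $x,y,z,w,q,p$; (A2) this system becomes again a polynomial Hamiltonian system in each of the coordinate systems $r_i=(x_i,y_i,z_i,w_i,q_i,p_i)$ $(i=0,1,2,3)$ given by $$\begin{aligned} r_0:\ &x_0=\tfrac1x,\ y_0=-\Big(\big(y+\tfrac{z^2}{4}\big)x+\alpha_0\Big)x,\ z_0=z,\ w_0=w+\tfrac{xz}{2},\ q_0=q,\ p_0=p;\\ r_1:\ &x_1=x,\ y_1=y,\ z_1=\tfrac1z,\ w_1=-(wz+\alpha_1)z,\ q_1=q,\ p_1=p;\\ r_2:\ &x_2=x-\tfrac z2,\ y_2=y+\tfrac{z^2}{4},\ z_2=\tfrac1z,\ w_2=-\Big(\big(w+\tfrac y2+p+t+\tfrac{xz}{2}-\tfrac{zq}{4}\big)z+\alpha_2\Big)z,\\ &q_2=q-z,\ p_2=p-\tfrac{z^2}{8};\\ r_3:\ &x_3=x,\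 y_3=y,\ z_3=z,\ w_3=w,\ q_3=\tfrac1q,\ p_3=-(pq+\alpha_3)q; \end{aligned}$$ that is, $K$ rewritten in the coordinates $r_j$ is a polynomial in $x_j,y_j,z_j,w_j,q_j,p_j$ for $j=0,1,3$, and $K-z$ rewritten in the coordinates $r_2$ is a polynomial in $x_2,y_2,z_2,w_2,q_2,p_2$ (with coefficients in $\mathbb{C}(t)$). Then such a system coincides with the Hamiltonian system $$\frac{dx}{dt}=\frac{\partial K}{\partial y},\quad \frac{dy}{dt}=-\frac{\partial K}{\partial x},\quad \frac{dz}{dt}=\frac{\partial K}{\partial w},\quad \frac{dw}{dt}=-\frac{\partial K}{\partial z},\quad \frac{dq}{dt}=\frac{\partial K}{\partial p},\quad \frac{dp}{dt}=-\frac{\partial K}{\partial q}$$ whose polynomial Hamiltonian is $$K=H+a_1(y+2p)+a_2(y+2p)^2+a_3(y+2p)^3+a_4(y+2p)^4$$ for some $a_1,a_2,a_3,a_4\in\mathbb{C}(t)$, where $H$ is the polynomial Hamiltonian given in the context.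
   Context: The Hamiltonian $H$, depending on $\alpha_0,\dots,\alpha_3$ with $\alpha_0+\alpha_1+\alpha_2+\alpha_3=1$, is $$\begin{aligned} H=&\frac{1}{4t}y^3+\frac{3}{2}y^2+\frac{3\alpha_3-1}{t}xy+\frac{3}{4t}z^2w^2+\frac{3}{2}z^2w+\frac{3\alpha_1+3\alpha_2-2}{2t}zw+\frac{3}{2}\alpha_1 z\\ &-\frac{4}{t}p^3-6p^2-\frac{3\alpha_1+3\alpha_2+3\alpha_3-2}{t}qp-6tp+\frac{3}{4t}\alpha_1(8xp+2zp+yz)+\frac{6}{t}\alpha_2xp\\ &+\frac{3}{2t}\alpha_3(4xp-yq)+\frac{3}{4t}\big(8xyqp-4zwqp+8xzwp-8x^2yp+2z^2wp+yz^2w\\ &-2yq^2p+8w^2p-4yp^2+4yw^2+4y^2w+8ywp-8xp+8tyw\big). \end{aligned}$$ Each $r_i$ is a birational (and symplectic) change of the variables $(x,y,z,w,q,p)$ over $\mathbb{C}(t)$; "rewriting in the coordinates $r_i$" means substituting for $x,y,z,w,q,p$ their expressions as rational functions of $x_i,y_i,z_i,w_i,q_i,p_i$ (and $t$). The correction $-z$ in the $r_2$ condition comes from the explicit $t$-dependence of $r_2$. Two Hamiltonian systems coincide if their equations are the same, i.e. their Hamiltonians differ by a function of $t$ only. *)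

theory Defs
  imports
    "HOL-Library.Poly_Mapping"
    "HOL-Computational_Algebra.Computational_Algebra"
begin

datatype coord = cx | cy | cz | cw | cq | cp

lemma UNIV_coord: "UNIV = {cx, cy, cz, cw, cq, cp}"
  using coord.exhaust by blast

instance coord :: finite
  by standard (simp add: UNIV_coord)

text \<open>The order on \<^typ>\<open>coord\<close> has no mathematical role: the library derives that a ring of
  multivariate polynomials is an integral domain only for linearly ordered variables.\<close>

primrec coord_index :: "coord \<Rightarrow> nat" where
  "coord_index cx = 0"
| "coord_index cy = 1"
| "coord_index cz = 2"
| "coord_index cw = 3"
| "coord_index cq = 4"
| "coord_index cp = 5"

instantiation coord :: linorder
begin

definition less_eq_coord :: "coord \<Rightarrow> coord \<Rightarrow> bool" where
  "less_eq_coord u v \<longleftrightarrow> coord_index u \<le> coord_index v"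

definition less_coord :: "coord \<Rightarrow> coord \<Rightarrow> bool" where
  "less_coord u v \<longleftrightarrow> coord_index u < coord_index v"

instance
proof
  fix u v :: coord
  assume "u \<le> v" and "v \<le> u"
  then show "u = v"
    by (cases u; cases v) (simp_all add: less_eq_coord_def)
qed (auto simp: less_eq_coord_def less_coord_def)

end

text \<open>\<open>ct\<close> is the field C(t), \<open>mpoly\<close> is C(t)[x,y,z,w,q,p] (exponent vectors
  mapped to coefficients) and \<open>ratfun\<close> is C(t)(x,y,z,w,q,p).\<close>

type_synonym ct = "complex poly fract"
type_synonym mpoly = "(coord \<Rightarrow>\<^sub>0 nat) \<Rightarrow>\<^sub>0 ct"
type_synonym ratfun = "mpoly fract"

definition tvar :: ct where
  "tvar = to_fract [:0, 1:]"

definition scal :: "complex \<Rightarrow> ct" where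
  "scal c = to_fract [:c:]"

definition Const :: "ct \<Rightarrow> mpoly" where
  "Const c = Poly_Mapping.single 0 c"

definition Var :: "coord \<Rightarrow> mpoly" where
  "Var v = Poly_Mapping.single (Poly_Mapping.single v 1) 1"

definition rconst :: "ct \<Rightarrow> ratfun" where
  "rconst c = to_fract (Const c)"

definition rvar :: "coord \<Rightarrow> ratfun" where
  "rvar v = to_fract (Var v)"

definition total_degree :: "mpoly \<Rightarrow> nat" where
  "total_degree F = Max (insert 0 ((\<lambda>m. \<Sum>v\<in>UNIV. Poly_Mapping.lookup m v) ` Poly_Mapping.keys F))"

definition partial :: "coord \<Rightarrow> mpoly \<Rightarrow> mpoly" where
  "partial v F = (\<Sum>m\<in>Poly_Mapping.keys F.
     Poly_Mapping.single (m - Poly_Mapping.single v 1)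
       (of_nat (Poly_Mapping.lookup m v) * Poly_Mapping.lookup F m))"

text \<open>Sextuples are always ordered \<open>(x, y, z, w, q, p)\<close>.\<close>

type_synonym 'a sextuple = "'a \<times> 'a \<times> 'a \<times> 'a \<times> 'a \<times> 'a"

fun component :: "'a sextuple \<Rightarrow> coord \<Rightarrow> 'a" where
  "component (x, y, z, w, q, p) cx = x"
| "component (x, y, z, w, q, p) cy = y"
| "component (x, y, z, w, q, p) cz = z"
| "component (x, y, z, w, q, p) cw = w"
| "component (x, y, z, w, q, p) cq = q"
| "component (x, y, z, w, q, p) cp = p"

definition substitute :: "mpoly \<Rightarrow> ratfun sextuple \<Rightarrow> ratfun" where
  "substitute F e = (\<Sum>m\<in>Poly_Mapping.keys F.
     rconst (Poly_Mapping.lookup F m) * (\<Prod>v\<in>UNIV. component e v ^ Poly_Mapping.lookup m v))"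

definition is_polynomial :: "ratfun \<Rightarrow> bool" where
  "is_polynomial f \<longleftrightarrow> (\<exists>L :: mpoly. f = to_fract L)"

text \<open>The right-hand sides of dx/dt, dy/dt, dz/dt, dw/dt, dq/dt, dp/dt.\<close>

definition hamiltonian_system :: "mpoly \<Rightarrow> mpoly sextuple" where
  "hamiltonian_system K =
    (partial cy K, - partial cx K, partial cw K, - partial cz K, partial cp K, - partial cq K)"

definition Ham :: "complex \<Rightarrow> complex \<Rightarrow> complex \<Rightarrow> mpoly" where
  "Ham \<alpha>\<^sub>1 \<alpha>\<^sub>2 \<alpha>\<^sub>3 =
    (let x = Var cx; y = Var cy; z = Var cz; w = Var cw; q = Var cq; p = Var cp;
         t = tvar; a1 = scal \<alpha>\<^sub>1; a2 = scal \<alpha>\<^sub>2; a3 = scal \<alpha>\<^sub>3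
     in Const (1 / (4 * t)) * y ^ 3 + Const (3 / 2) * y ^ 2 + Const ((3 * a3 - 1) / t) * x * y
      + Const (3 / (4 * t)) * z ^ 2 * w ^ 2 + Const (3 / 2) * z ^ 2 * w
      + Const ((3 * a1 + 3 * a2 - 2) / (2 * t)) * z * w + Const (3 / 2 * a1) * z
      - Const (4 / t) * p ^ 3 - 6 * p ^ 2
      - Const ((3 * a1 + 3 * a2 + 3 * a3 - 2) / t) * q * p - Const (6 * t) * p
      + Const (3 / (4 * t) * a1) * (8 * x * p + 2 * z * p + y * z) + Const (6 / t * a2) * x * p
      + Const (3 / (2 * t) * a3) * (4 * x * p - y * q)
      + Const (3 / (4 * t)) *
         (8 * x * y * q * p - 4 * z * w * q * p + 8 * x * z * w * p - 8 * x ^ 2 * y * p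
          + 2 * z ^ 2 * w * p + y * z ^ 2 * w
          - 2 * y * q ^ 2 * p + 8 * w ^ 2 * p - 4 * y * p ^ 2 + 4 * y * w ^ 2 + 4 * y ^ 2 * w
          + 8 * y * w * p - 8 * x * p + Const (8 * t) * y * w))"

definition r0 :: "'a::field \<Rightarrow> 'a sextuple \<Rightarrow> 'a sextuple" where
  "r0 \<alpha>\<^sub>0 = (\<lambda>(x, y, z, w, q, p).
     (1 / x, - ((y + z ^ 2 / 4) * x + \<alpha>\<^sub>0) * x, z, w + x * z / 2, q, p))"

definition r1 :: "'a::field \<Rightarrow> 'a sextuple \<Rightarrow> 'a sextuple" where
  "r1 \<alpha>\<^sub>1 = (\<lambda>(x, y, z, w, q, p). (x, y, 1 / z, - (w * z + \<alpha>\<^sub>1) * z, q, p))"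

definition r2 :: "'a::field \<Rightarrow> 'a \<Rightarrow> 'a sextuple \<Rightarrow> 'a sextuple" where
  "r2 t \<alpha>\<^sub>2 = (\<lambda>(x, y, z, w, q, p).
     (x - z / 2, y + z ^ 2 / 4, 1 / z,
      - ((w + y / 2 + p + t + x * z / 2 - z * q / 4) * z + \<alpha>\<^sub>2) * z,
      q - z, p - z ^ 2 / 8))"

definition r3 :: "'a::field \<Rightarrow> 'a sextuple \<Rightarrow> 'a sextuple" where
  "r3 \<alpha>\<^sub>3 = (\<lambda>(x, y, z, w, q, p). (x, y, z, w, 1 / q, - (p * q + \<alpha>\<^sub>3) * q))"

text \<open>\<open>old_coords r\<close> solves \<open>r (x, y, z, w, q, p) = (x\<^sub>i, y\<^sub>i, z\<^sub>i, w\<^sub>i, q\<^sub>i, p\<^sub>i)\<close> for the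
  old coordinates in the field of rational functions of the new ones; the new ones are
  represented by the six variables of \<^typ>\<open>ratfun\<close>. The lemmas \<open>r0_inverse\<close> to
  \<open>r3_inverse\<close> show that the solution exists and is unique.\<close>

definition new_coords :: "ratfun sextuple" where
  "new_coords = (rvar cx, rvar cy, rvar cz, rvar cw, rvar cq, rvar cp)"

definition old_coords :: "(ratfun sextuple \<Rightarrow> ratfun sextuple) \<Rightarrow> ratfun sextuple" where
  "old_coords r = (THE e. r e = new_coords)"

text \<open>Since \<open>r2\<close> depends explicitly on t, the Hamiltonian of the system transformed by \<open>r2\<close>
  is \<open>K - z\<close>, not \<open>K\<close>, rewritten in the new coordinates.\<close>

definition rewrite_in :: "(ratfun sextuple \<Rightarrow> ratfun sextuple) \<Rightarrow> mpoly \<Rightarrow> ratfun" where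
  "rewrite_in r F = substitute F (old_coords r)"

instance fract :: ("{idom, ring_char_0}") field_char_0
proof
  show "inj (of_nat :: nat \<Rightarrow> 'a fract)"
    by (auto simp: inj_on_def of_nat_fract eq_fract)
qed

lemma rvar_nonzero: "rvar v \<noteq> 0"
proof
  assume "rvar v = 0"
  then have "Var v = 0"
    by (simp add: rvar_def)
  then have "Poly_Mapping.lookup (Var v) (Poly_Mapping.single v 1) = 0"
    by simp
  then show False
    by (simp add: Var_def)
qed

lemma one_div_eq_iff:
  fixes u :: "'a::field"
  assumes "u \<noteq> 0"
  shows "1 / v = u \<longleftrightarrow> v = 1 / u"
  using assms by auto

lemma momentum_inverse:
  fixes u :: "'a::field"
  assumes "u \<noteq> 0"
  shows "- (V * (1 / u) + a) * (1 / u) = v \<longleftrightarrow> V = - (u * v + a) * u"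
proof
  assume "- (V * (1 / u) + a) * (1 / u) = v"
  then have "- (V * (1 / u) + a) * ((1 / u) * u) = u * v"
    by (metis mult.assoc mult.commute)
  then have "- (V * (1 / u) + a) = u * v"
    using assms by simp
  then have "V * (1 / u) = - (u * v + a)"
    by (simp add: eq_neg_iff_add_eq_0 algebra_simps)
  then have "V * ((1 / u) * u) = - (u * v + a) * u"
    by (metis mult.assoc)
  then show "V = - (u * v + a) * u"
    using assms by simp
next
  assume "V = - (u * v + a) * u"
  then have "V * (1 / u) = - (u * v + a)"
    using assms by simp
  then show "- (V * (1 / u) + a) * (1 / u) = v"
    using assms by simp
qed

lemma r0_inverse:
  fixes a :: "'a::field_char_0"
  assumes "x \<noteq> 0"
  shows "r0 a e = (x, y, z, w, q, p) \<longleftrightarrow>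
    e = (1 / x, - (x * y + a) * x - z ^ 2 / 4, z, w - z / (2 * x), q, p)"
proof (cases e)
  case (fields x' y' z' w' q' p')
  show ?thesis
  proof (cases "x' = 1 / x")
    case True
    have "- ((y' + z' ^ 2 / 4) * x' + a) * x' = y \<longleftrightarrow> y' = - (x * y + a) * x - z' ^ 2 / 4"
      using momentum_inverse[OF assms, of "y' + z' ^ 2 / 4" a y] True
      by (simp only: eq_diff_eq)
    moreover have "w' + x' * z' / 2 = w \<longleftrightarrow> w' = w - z' / (2 * x)"
      using True by (auto simp: eq_diff_eq mult.commute)
    moreover have "1 / x' = x"
      using True assms by simp
    ultimately show ?thesis
      unfolding fields True[symmetric] r0_def prod.case prod.inject by blast
  next
    case False
    then show ?thesis
      using assms fields by (auto simp: r0_def one_div_eq_iff)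
  qed
qed

lemma r1_inverse:
  fixes a :: "'a::field_char_0"
  assumes "z \<noteq> 0"
  shows "r1 a e = (x, y, z, w, q, p) \<longleftrightarrow> e = (x, y, 1 / z, - (z * w + a) * z, q, p)"
proof (cases e)
  case (fields x' y' z' w' q' p')
  show ?thesis
  proof (cases "z' = 1 / z")
    case True
    have "- (w' * z' + a) * z' = w \<longleftrightarrow> w' = - (z * w + a) * z"
      using momentum_inverse[OF assms, of w' a w] True by (simp only:)
    moreover have "1 / z' = z"
      using True assms by simp
    ultimately show ?thesis
      unfolding fields True[symmetric] r1_def prod.case prod.inject by blast
  next
    case False
    then show ?thesis
      using assms fields by (auto simp: r1_def one_div_eq_iff)
  qed
qed

lemma r2_inverse:
  fixes a :: "'a::field_char_0"
  assumes "z \<noteq> 0"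
  shows "r2 t a e = (x, y, z, w, q, p) \<longleftrightarrow>
    e = (x + 1 / (2 * z), y - 1 / (4 * z ^ 2), 1 / z,
         - (z * w + a) * z - y / 2 - p - t - x / (2 * z) + q / (4 * z),
         q + 1 / z, p + 1 / (8 * z ^ 2))"
proof (cases e)
  case (fields x' y' z' w' q' p')
  define W where "W = w' + y' / 2 + p' + t + x' * z' / 2 - z' * q' / 4"
  have w_iff: "- (W * z' + a) * z' = w \<longleftrightarrow>
      w' = - (z * w + a) * z - y / 2 - p - t - x / (2 * z) + q / (4 * z)"
    if "x' = x + 1 / (2 * z)" "y' = y - 1 / (4 * z ^ 2)" "z' = 1 / z"
       "q' = q + 1 / z" "p' = p + 1 / (8 * z ^ 2)"
  proof -
    have "x' = x + z' / 2" "y' = y - z' ^ 2 / 4" "q' = q + z'" "p' = p + z' ^ 2 / 8"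
      using that by (simp_all add: power_divide)
    then have "W = w' + (y / 2 + p + t + x * z' / 2 - z' * q / 4)"
      by (simp only: W_def) (simp add: field_simps power2_eq_square)
    moreover have rhs: "- (z * w + a) * z - y / 2 - p - t - x / (2 * z) + q / (4 * z) =
        - (z * w + a) * z - (y / 2 + p + t + x * z' / 2 - z' * q / 4)"
      using \<open>z' = 1 / z\<close> by (simp add: mult.commute)
    moreover have "- (W * z' + a) * z' = w \<longleftrightarrow> W = - (z * w + a) * z"
      using momentum_inverse[OF assms, of W a w] \<open>z' = 1 / z\<close> by (simp only:)
    ultimately show ?thesis
      unfolding rhs eq_diff_eq by (simp only:)
  qed
  have "r2 t a e = (x, y, z, w, q, p) \<longleftrightarrow>
      x' = x + 1 / (2 * z) \<and> y' = y - 1 / (4 * z ^ 2) \<and> z' = 1 / z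
      \<and> - (W * z' + a) * z' = w \<and> q' = q + 1 / z \<and> p' = p + 1 / (8 * z ^ 2)"
  proof (cases "z' = 1 / z")
    case True
    have "x' - z' / 2 = x \<longleftrightarrow> x' = x + 1 / (2 * z)"
      using True by (auto simp: algebra_simps)
    moreover have "y' + z' ^ 2 / 4 = y \<longleftrightarrow> y' = y - 1 / (4 * z ^ 2)"
      using True by (auto simp: power_divide algebra_simps)
    moreover have "q' - z' = q \<longleftrightarrow> q' = q + 1 / z"
      using True by (auto simp: algebra_simps)
    moreover have "p' - z' ^ 2 / 8 = p \<longleftrightarrow> p' = p + 1 / (8 * z ^ 2)"
      using True by (auto simp: power_divide algebra_simps)
    moreover have "1 / z' = z"
      using True assms by simp
    ultimately show ?thesis
      unfolding fields True[symmetric] W_def r2_def prod.case prod.inject by blast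
  next
    case False
    then show ?thesis
      using assms fields by (auto simp: r2_def one_div_eq_iff)
  qed
  then show ?thesis
    using fields w_iff by auto
qed

lemma r3_inverse:
  fixes a :: "'a::field_char_0"
  assumes "q \<noteq> 0"
  shows "r3 a e = (x, y, z, w, q, p) \<longleftrightarrow> e = (x, y, z, w, 1 / q, - (q * p + a) * q)"
proof (cases e)
  case (fields x' y' z' w' q' p')
  show ?thesis
  proof (cases "q' = 1 / q")
    case True
    have "- (p' * q' + a) * q' = p \<longleftrightarrow> p' = - (q * p + a) * q"
      using momentum_inverse[OF assms, of p' a p] True by (simp only:)
    moreover have "1 / q' = q"
      using True assms by simp
    ultimately show ?thesis
      unfolding fields True[symmetric] r3_def prod.case prod.inject by blast
  next
    case False
    then show ?thesis
      using assms fields by (auto simp: r3_def one_div_eq_iff)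
  qed
qed

lemma old_coords_r0:
  "old_coords (r0 a) =
    (1 / rvar cx, - (rvar cx * rvar cy + a) * rvar cx - rvar cz ^ 2 / 4, rvar cz,
     rvar cw - rvar cz / (2 * rvar cx), rvar cq, rvar cp)"
  by (simp add: old_coords_def new_coords_def r0_inverse rvar_nonzero)

lemma old_coords_r1:
  "old_coords (r1 a) =
    (rvar cx, rvar cy, 1 / rvar cz, - (rvar cz * rvar cw + a) * rvar cz, rvar cq, rvar cp)"
  by (simp add: old_coords_def new_coords_def r1_inverse rvar_nonzero)

lemma old_coords_r2:
  "old_coords (r2 t a) =
    (rvar cx + 1 / (2 * rvar cz), rvar cy - 1 / (4 * rvar cz ^ 2), 1 / rvar cz,
     - (rvar cz * rvar cw + a) * rvar cz - rvar cy / 2 - rvar cp - t - rvar cx / (2 * rvar cz)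
       + rvar cq / (4 * rvar cz),
     rvar cq + 1 / rvar cz, rvar cp + 1 / (8 * rvar cz ^ 2))"
  by (simp add: old_coords_def new_coords_def r2_inverse rvar_nonzero)

lemma old_coords_r3:
  "old_coords (r3 a) =
    (rvar cx, rvar cy, rvar cz, rvar cw, 1 / rvar cq, - (rvar cq * rvar cp + a) * rvar cq)"
  by (simp add: old_coords_def new_coords_def r3_inverse rvar_nonzero)

lemma lookup_partial:
  "Poly_Mapping.lookup (partial v F) m =
    of_nat (Suc (Poly_Mapping.lookup m v)) * Poly_Mapping.lookup F (m + Poly_Mapping.single v 1)"
proof -
  let ?s = "Poly_Mapping.single v (1::nat)"
  let ?c = "\<lambda>n. of_nat (Poly_Mapping.lookup n v) * Poly_Mapping.lookup F n"
  have shift: "n = m + ?s" if "n - ?s = m" "Poly_Mapping.lookup n v \<noteq> 0" for n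
  proof (rule poly_mapping_eqI)
    fix u
    have "Poly_Mapping.lookup (n - ?s) u = Poly_Mapping.lookup m u"
      using that by simp
    then show "Poly_Mapping.lookup n u = Poly_Mapping.lookup (m + ?s) u"
      using that(2) by (cases "u = v") (auto simp: lookup_minus lookup_add lookup_single)
  qed
  have "Poly_Mapping.lookup (partial v F) m =
      (\<Sum>n\<in>Poly_Mapping.keys F. if n - ?s = m then ?c n else 0)"
    by (simp add: partial_def lookup_sum lookup_single when_def)
  also have "\<dots> = (\<Sum>n\<in>Poly_Mapping.keys F. if n = m + ?s then ?c n else 0)"
  proof (rule sum.cong)
    fix n
    show "(if n - ?s = m then ?c n else 0) = (if n = m + ?s then ?c n else 0)"
    proof (cases "Poly_Mapping.lookup n v = 0")
      case True
      then show ?thesis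
        by simp
    next
      case False
      then have "n - ?s = m \<longleftrightarrow> n = m + ?s"
        using shift[of n] add_diff_cancel_right'[of m ?s] by blast
      then show ?thesis
        by (simp only:)
    qed
  qed simp
  also have "\<dots> = ?c (m + ?s)"
    by (simp add: sum.delta' in_keys_iff)
  finally show ?thesis
    by (simp add: lookup_add)
qed

text \<open>Two Hamiltonian systems coincide iff their Hamiltonians differ by a function of t only.\<close>

lemma hamiltonian_system_eq_iff:
  "hamiltonian_system K = hamiltonian_system L \<longleftrightarrow> (\<exists>c. K = L + Const c)"
proof
  assume eq: "hamiltonian_system K = hamiltonian_system L"
  have partials: "partial v K = partial v L" for v
    using eq by (cases v) (simp_all add: hamiltonian_system_def)
  have "Poly_Mapping.lookup K m = Poly_Mapping.lookup L m" if "m \<noteq> 0" for m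
  proof -
    obtain v where v: "Poly_Mapping.lookup m v \<noteq> 0"
      using \<open>m \<noteq> 0\<close> by (metis lookup_zero poly_mapping_eqI)
    define n where "n = m - Poly_Mapping.single v 1"
    have "m = n + Poly_Mapping.single v 1"
      by (rule poly_mapping_eqI)
        (use v in \<open>auto simp: n_def lookup_add lookup_minus lookup_single when_def\<close>)
    moreover have "Poly_Mapping.lookup (partial v K) n = Poly_Mapping.lookup (partial v L) n"
      using partials by simp
    ultimately show ?thesis
      by (simp add: lookup_partial del: of_nat_Suc)
  qed
  then have "K = L + Const (Poly_Mapping.lookup K 0 - Poly_Mapping.lookup L 0)"
    by (intro poly_mapping_eqI) (auto simp: Const_def lookup_add lookup_single when_def)
  then show "\<exists>c. K = L + Const c" ..
next
  assume "\<exists>c. K = L + Const c"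
  then obtain c where "K = L + Const c" ..
  moreover have "m + Poly_Mapping.single v 1 \<noteq> 0" for m :: "coord \<Rightarrow>\<^sub>0 nat" and v
  proof
    assume "m + Poly_Mapping.single v 1 = 0"
    then have "Poly_Mapping.lookup (m + Poly_Mapping.single v 1) v = 0"
      by simp
    then show False
      by (simp add: lookup_add)
  qed
  ultimately have "partial v K = partial v L" for v
    by (intro poly_mapping_eqI) (simp add: lookup_partial lookup_add Const_def lookup_single when_def)
  then show "hamiltonian_system K = hamiltonian_system L"
    by (simp add: hamiltonian_system_def)
qed

end

theory Submission
  imports Defs
begin

text \<open>
  Why the theorem holds. Give x, z, q the weight 1 and y, w, p the weight 2. Each of the four
  coordinate changes becomes weighted homogeneous if moreover t has weight 2 and every
  \<open>\<alpha>\<close> has weight 3. Hence t and the \<open>\<alpha>\<close>s disappear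
  when only the terms of K of highest weight n are kept; let T be their sum.

  The conditions are exploited on the hypersurface where the new momentum (\<open>y\<^sub>0\<close>,
  \<open>w\<^sub>1\<close>, \<open>w\<^sub>2\<close> or \<open>p\<^sub>3\<close>) vanishes. There the old
  coordinates have a pole in one new variable only, and K, or K - z in the case of
  \<open>r\<^sub>2\<close>, must not have one (\<open>pole_free\<close>). For T this means invariance
  along a curve: T restricted to the curve is a polynomial in its parameter s which is also
  a polynomial in 1 / s, so it is constant (\<open>leading_part_constant\<close>). The four
  resulting identities (\<open>leading_part_0\<close> to \<open>leading_part_3\<close>) say that,
  on each of the hypersurfaces

    y + z^2/4 = 0,   w = 0,   w + y/2 + p + xz/2 - zq/4 = 0,   p = 0,

  T is invariant under the Hamiltonian flow of the defining function. They form a linear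
  problem without parameters for the coefficients of T. The conditions from
  \<open>r\<^sub>0\<close> and \<open>r\<^sub>1\<close> involve x, y, z, w only; in degree at most 4
  they leave at most fifteen free coefficients for each monomial in q and p
  (\<open>quartic_eq_normal_form\<close>), and the condition from \<open>r\<^sub>3\<close> excludes the monomials with a
  power of q but none of p. In each weight the condition from \<open>r\<^sub>2\<close> is then a system of
  linear equations with at most twelve unknowns, whose solutions are
  (\<open>leading_solution_1\<close> to \<open>leading_solution_8\<close>): T = 0 if n is odd, T is a
  multiple of (y + 2p)^(n/2) if n is 2, 4 or 8, and for n = 6 one further solution
  occurs, the part of weight 6 of tH.

  Both y + 2p and H satisfy the conditions, in the case of H because the
  \<open>\<alpha>\<close>s add up to 1 (\<open>pole_free_Ham_0\<close> to \<open>pole_free_Ham_3\<close>). So multiples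
  of powers of y + 2p and a multiple sH can be subtracted from K, starting in
  weight 8, until the weight drops to 1. The remainder is then subject to the conditions with
  (1 - s) z in place of z, and in weight 1 these force the remainder to be constant and s = 1.
\<close>

section \<open>Evaluation of polynomials and of rational functions\<close>

definition monomial_value :: "(coord \<Rightarrow> ct) \<Rightarrow> (coord \<Rightarrow>\<^sub>0 nat) \<Rightarrow> ct" where
  "monomial_value v m = (\<Prod>u\<in>UNIV. v u ^ Poly_Mapping.lookup m u)"

definition ev :: "mpoly \<Rightarrow> (coord \<Rightarrow> ct) \<Rightarrow> ct" where
  "ev F v = (\<Sum>m\<in>Poly_Mapping.keys F. Poly_Mapping.lookup F m * monomial_value v m)"

lemma ev_superset:
  assumes "finite S" "Poly_Mapping.keys F \<subseteq> S"
  shows "ev F v = (\<Sum>m\<in>S. Poly_Mapping.lookup F m * monomial_value v m)"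
  unfolding ev_def using assms
  by (intro sum.mono_neutral_left) (auto simp: in_keys_iff)

lemma monomial_value_add: "monomial_value v (m + n) = monomial_value v m * monomial_value v n"
  by (simp add: monomial_value_def lookup_add power_add prod.distrib)

lemma monomial_value_0 [simp]: "monomial_value v 0 = 1"
  by (simp add: monomial_value_def)

lemma monomial_value_single [simp]: "monomial_value v (Poly_Mapping.single u k) = v u ^ k"
proof -
  have "monomial_value v (Poly_Mapping.single u k) = (\<Prod>u'\<in>UNIV. if u' = u then v u ^ k else 1)"
    unfolding monomial_value_def by (intro prod.cong) (auto simp: lookup_single when_def)
  then show ?thesis by simp
qed

lemma ev_single [simp]: "ev (Poly_Mapping.single m c) v = c * monomial_value v m"
  by (simp add: ev_superset[of "{m}"] keys_single)

lemma ev_0 [simp]: "ev 0 v = 0"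
  by (simp add: ev_def)

lemma ev_add [simp]: "ev (F + G) v = ev F v + ev G v"
  using keys_add[of F G]
  by (simp add: ev_superset[of "Poly_Mapping.keys F \<union> Poly_Mapping.keys G"]
      lookup_add distrib_right sum.distrib)

lemma ev_uminus [simp]: "ev (- F) v = - ev F v"
  using ev_add[of F "- F" v] by (simp add: eq_neg_iff_add_eq_0 add.commute)

lemma ev_diff [simp]: "ev (F - G) v = ev F v - ev G v"
  using ev_add[of F "- G" v] by simp

lemma ev_sum: "ev (sum f A) v = (\<Sum>a\<in>A. ev (f a) v)"
  by (induction A rule: infinite_finite_induct) auto

lemma sum_of_monomials:
  fixes F :: "'a \<Rightarrow>\<^sub>0 'b::comm_monoid_add"
  shows "F = (\<Sum>m\<in>Poly_Mapping.keys F. Poly_Mapping.single m (Poly_Mapping.lookup F m))"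
  by (rule poly_mapping_eqI)
    (simp add: lookup_sum lookup_single when_def in_keys_iff)

lemma ev_mult [simp]: "ev (F * G) v = ev F v * ev G v"
proof -
  have "F * G = (\<Sum>m\<in>Poly_Mapping.keys F. \<Sum>n\<in>Poly_Mapping.keys G.
      Poly_Mapping.single (m + n) (Poly_Mapping.lookup F m * Poly_Mapping.lookup G n))"
    by (subst sum_of_monomials[of F], subst sum_of_monomials[of G])
      (simp add: sum_product mult_single)
  then have "ev (F * G) v = (\<Sum>m\<in>Poly_Mapping.keys F. \<Sum>n\<in>Poly_Mapping.keys G.
      (Poly_Mapping.lookup F m * monomial_value v m) * (Poly_Mapping.lookup G n * monomial_value v n))"
    by (simp add: ev_sum monomial_value_add mult_ac)
  then show ?thesis
    by (simp add: ev_def sum_product)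
qed

lemma ev_Const [simp]: "ev (Const c) v = c"
  by (simp add: Const_def)

lemma ev_Var [simp]: "ev (Var u) v = v u"
  by (simp add: Var_def)

lemma ev_1 [simp]: "ev 1 v = 1"
  using ev_Const[of 1 v] by (simp add: Const_def single_one)

lemma ev_numeral [simp]: "ev (numeral n) v = numeral n"
  by (induction n) (simp_all only: numeral.simps ev_add ev_1)

lemma ev_power [simp]: "ev (F ^ n) v = ev F v ^ n"
  by (induction n) auto

text \<open>A relation rather than a function: a rational function has no value at a pole. It serves
  to turn an identity between rational functions into identities between values.\<close>

definition takes_value :: "ratfun \<Rightarrow> (coord \<Rightarrow> ct) \<Rightarrow> ct \<Rightarrow> bool" where
  "takes_value f v c \<longleftrightarrow>
    (\<exists>A B. ev B v \<noteq> 0 \<and> f * to_fract B = to_fract A \<and> c * ev B v = ev A v)"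

lemma takes_value_to_fract: "c = ev L v \<Longrightarrow> takes_value (to_fract L) v c"
  unfolding takes_value_def by (rule exI[of _ L], rule exI[of _ 1]) simp

text \<open>Values of polynomials are unique, because the equation that witnesses the value holds
  in the polynomial ring itself.\<close>
lemma takes_value_to_fract_D:
  assumes "takes_value (to_fract L) v c"
  shows "c = ev L v"
proof -
  obtain A B where B: "ev B v \<noteq> 0" and eq: "to_fract L * to_fract B = to_fract A"
    and c: "c * ev B v = ev A v"
    using assms unfolding takes_value_def by blast
  have "L * B = A"
    using eq by (simp flip: to_fract_mult)
  then have "c * ev B v = ev L v * ev B v"
    using c by auto
  then show ?thesis using B by simp
qed

lemma takes_value_add:
  assumes "takes_value f v c" "takes_value g v d"
  shows "takes_value (f + g) v (c + d)"
proof -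
  obtain A B where 1: "ev B v \<noteq> 0" "f * to_fract B = to_fract A" "c * ev B v = ev A v"
    using assms unfolding takes_value_def by blast
  obtain A' B' where 2: "ev B' v \<noteq> 0" "g * to_fract B' = to_fract A'" "d * ev B' v = ev A' v"
    using assms unfolding takes_value_def by blast
  have "(f + g) * to_fract (B * B') = (f * to_fract B) * to_fract B' + (g * to_fract B') * to_fract B"
    by (simp add: algebra_simps to_fract_mult)
  also have "\<dots> = to_fract (A * B' + A' * B)"
    using 1 2 by (simp add: to_fract_mult to_fract_add)
  moreover have "(c + d) * ev (B * B') v = (c * ev B v) * ev B' v + (d * ev B' v) * ev B v"
    by (simp add: algebra_simps)
  moreover have "\<dots> = ev (A * B' + A' * B) v"
    using 1 2 by simp
  moreover have "ev (B * B') v \<noteq> 0" using 1 2 by simp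
  ultimately show ?thesis unfolding takes_value_def by metis
qed

lemma takes_value_mult:
  assumes "takes_value f v c" "takes_value g v d"
  shows "takes_value (f * g) v (c * d)"
proof -
  obtain A B where 1: "ev B v \<noteq> 0" "f * to_fract B = to_fract A" "c * ev B v = ev A v"
    using assms unfolding takes_value_def by blast
  obtain A' B' where 2: "ev B' v \<noteq> 0" "g * to_fract B' = to_fract A'" "d * ev B' v = ev A' v"
    using assms unfolding takes_value_def by blast
  have "(f * g) * to_fract (B * B') = (f * to_fract B) * (g * to_fract B')"
    by (simp add: to_fract_mult)
  also have "\<dots> = to_fract (A * A')"
    using 1 2 by (simp add: to_fract_mult)
  moreover have "(c * d) * ev (B * B') v = (c * ev B v) * (d * ev B' v)"
    by simp
  moreover have "\<dots> = ev (A * A') v"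
    using 1 2 by simp
  moreover have "ev (B * B') v \<noteq> 0" using 1 2 by simp
  ultimately show ?thesis unfolding takes_value_def by metis
qed

lemma takes_value_const:
  "takes_value 0 v 0" "takes_value 1 v 1" "takes_value (rconst c) v c"
  using takes_value_to_fract[of 0 0] takes_value_to_fract[of 1 1] takes_value_to_fract[of c "Const c"]
  by (simp_all add: rconst_def)

lemma takes_value_rvar: "takes_value (rvar u) v (v u)"
  unfolding rvar_def by (rule takes_value_to_fract) simp

lemma takes_value_numeral: "takes_value (numeral n) v (numeral n)"
proof (induction n)
  case One
  then show ?case using takes_value_const(2) by simp
next
  case (Bit0 n)
  then show ?case using takes_value_add by (simp only: numeral.simps)
next
  case (Bit1 n)
  then show ?case using takes_value_add takes_value_const(2) by (simp only: numeral.simps)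
qed

lemma takes_value_uminus:
  assumes "takes_value f v c"
  shows "takes_value (- f) v (- c)"
proof -
  have "takes_value (- 1) v (- 1)"
    using takes_value_to_fract[of "- 1" "- 1" v] by (simp add: to_fract_uminus)
  from takes_value_mult[OF this assms] show ?thesis by simp
qed

lemma takes_value_diff:
  assumes "takes_value f v c" "takes_value g v d"
  shows "takes_value (f - g) v (c - d)"
  using takes_value_add[OF assms(1) takes_value_uminus[OF assms(2)]] by simp

lemma takes_value_divide:
  assumes f: "takes_value f v c" and g: "takes_value g v d" and "d \<noteq> 0"
  shows "takes_value (f / g) v (c / d)"
proof -
  obtain A B where 1: "ev B v \<noteq> 0" "g * to_fract B = to_fract A" "d * ev B v = ev A v"
    using g unfolding takes_value_def by blast
  have A: "ev A v \<noteq> 0" using 1 \<open>d \<noteq> 0\<close> by (metis no_zero_divisors)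
  have "g \<noteq> 0" using A 1(2) by auto
  have "(1 / g) * to_fract A = to_fract B"
    using \<open>g \<noteq> 0\<close> unfolding 1(2)[symmetric] by simp
  moreover have "(1 / d) * ev A v = ev B v"
    using \<open>d \<noteq> 0\<close> unfolding 1(3)[symmetric] by simp
  ultimately have "takes_value (1 / g) v (1 / d)"
    unfolding takes_value_def using A by blast
  from takes_value_mult[OF f this] show ?thesis by simp
qed

lemma takes_value_power:
  assumes "takes_value f v c"
  shows "takes_value (f ^ n) v (c ^ n)"
  by (induction n) (use assms in \<open>auto intro: takes_value_mult takes_value_const\<close>)

lemma takes_value_sum:
  assumes "\<And>a. a \<in> A \<Longrightarrow> takes_value (f a) v (c a)"
  shows "takes_value (sum f A) v (sum c A)"
  using assms
  by (induction A rule: infinite_finite_induct) (auto intro: takes_value_add takes_value_const)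

lemma takes_value_prod:
  assumes "\<And>a. a \<in> A \<Longrightarrow> takes_value (f a) v (c a)"
  shows "takes_value (prod f A) v (prod c A)"
  using assms
  by (induction A rule: infinite_finite_induct) (auto intro: takes_value_mult takes_value_const)

lemma takes_value_substitute:
  assumes "\<And>u. takes_value (component e u) v (b u)"
  shows "takes_value (substitute F e) v (ev F b)"
  unfolding substitute_def ev_def monomial_value_def
  by (intro takes_value_sum takes_value_mult takes_value_const takes_value_prod
      takes_value_power assms)

section \<open>Weights and parts of highest weight\<close>

fun wt :: "coord \<Rightarrow> nat" where
  "wt cx = 1" | "wt cy = 2" | "wt cz = 1" | "wt cw = 2" | "wt cq = 1" | "wt cp = 2"

definition weight :: "(coord \<Rightarrow>\<^sub>0 nat) \<Rightarrow> nat" where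
  "weight m = (\<Sum>u\<in>UNIV. wt u * Poly_Mapping.lookup m u)"

definition weight_part :: "nat \<Rightarrow> mpoly \<Rightarrow> mpoly" where
  "weight_part n F = (\<Sum>m | m \<in> Poly_Mapping.keys F \<and> weight m = n.
     Poly_Mapping.single m (Poly_Mapping.lookup F m))"

definition weight_le :: "nat \<Rightarrow> mpoly \<Rightarrow> bool" where
  "weight_le n F \<longleftrightarrow> (\<forall>m\<in>Poly_Mapping.keys F. weight m \<le> n)"

lemma lookup_weight_part:
  "Poly_Mapping.lookup (weight_part n F) m = (if weight m = n then Poly_Mapping.lookup F m else 0)"
  by (simp add: weight_part_def lookup_sum lookup_single when_def in_keys_iff sum.delta)

lemma ev_weight_part:
  "ev (weight_part n F) v =
    (\<Sum>m\<in>Poly_Mapping.keys F. (if weight m = n then Poly_Mapping.lookup F m else 0) * monomial_value v m)"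
  by (subst ev_superset[of "Poly_Mapping.keys F"])
    (auto simp: lookup_weight_part in_keys_iff split: if_splits)

lemma poly_eqI_off_zero:
  fixes p r :: "'a::field_char_0 poly"
  assumes "\<And>x. x \<noteq> 0 \<Longrightarrow> poly p x = poly r x"
  shows "p = r"
proof -
  have "poly (monom 1 1 * (p - r)) x = 0" for x
    using assms[of x] by (cases "x = 0") (auto simp: poly_monom)
  then have "monom 1 1 * (p - r) = 0"
    using poly_all_0_iff_0 by blast
  then show ?thesis by simp
qed

text \<open>Multiplying by x to the power \<^term>\<open>degree r\<close> turns the right-hand side into a polynomial of
  degree at most \<^term>\<open>degree r\<close>, while it raises the degree of p by \<^term>\<open>degree r\<close>.\<close>
lemma constant_if_polynomial_in_inverse:
  fixes p r :: "'a::field_char_0 poly"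
  assumes "\<And>x. x \<noteq> 0 \<Longrightarrow> poly p x = poly r (1 / x)"
  shows "poly p x = poly p 0"
proof -
  have "p * monom 1 (degree r) = reflect_poly r"
    by (rule poly_eqI_off_zero)
      (simp add: assms poly_monom poly_reflect_poly_nz inverse_eq_divide mult.commute)
  then have "degree p = 0"
    using degree_reflect_poly_le[of r] degree_mult_eq[of p "monom 1 (degree r)"]
    by (cases "p = 0") (auto simp: degree_monom_eq)
  then obtain c where "p = [:c:]"
    by (rule degree_eq_zeroE)
  then show ?thesis by simp
qed

lemma monomial_value_divide: "monomial_value (\<lambda>u. f u / g u) m = monomial_value f m / monomial_value g m"
  by (simp add: monomial_value_def power_divide prod_dividef)

lemma monomial_value_power_wt: "monomial_value (\<lambda>u. e ^ wt u) m = e ^ weight m"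
  by (simp add: monomial_value_def weight_def power_mult power_sum)

text \<open>The mechanism that extracts a condition on the leading part. Here d is the new coordinate
  in which the old ones have a pole, and \<open>d'\<close> the momentum that is set to zero. The new coordinates
  other than d are scaled by powers of 1 / e according to their weights, and d itself is e / s:
  it is the inverse of an old coordinate of weight 1. The hypothesis on \<open>old\<close> says that the
  old coordinates then scale according to their weights, up to terms that vanish at e = 0; in
  the applications these are the terms with t and the \<open>\<alpha>\<close>s. Multiplied by the n-th power
  of e and evaluated at e = 0, F becomes its part of weight n. On the other side the polynomial L
  depends on s only through 1 / s.\<close>
lemma leading_part_constant:
  fixes c :: "coord \<Rightarrow> ct" and b :: "ct \<Rightarrow> coord \<Rightarrow> ct poly" and \<beta> :: "coord \<Rightarrow> ct poly"
  assumes reg: "\<exists>L. \<forall>v. v d \<noteq> 0 \<longrightarrow> v d' = 0 \<longrightarrow> ev F (old v) = ev L v"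
    and "d' \<noteq> d" and le: "weight_le n F" and "c d' = 0"
    and old: "\<And>e s. e \<noteq> 0 \<Longrightarrow> s \<noteq> 0 \<Longrightarrow>
      old (\<lambda>u. if u = d then e / s else c u / e ^ wt u) = (\<lambda>u. poly (b s u) e / e ^ wt u)"
    and lead: "\<And>s u. s \<noteq> 0 \<Longrightarrow> poly (b s u) 0 = poly (\<beta> u) s"
  shows "ev (weight_part n F) (\<lambda>u. poly (\<beta> u) s) = ev (weight_part n F) (\<lambda>u. poly (\<beta> u) 0)"
proof -
  obtain L where L: "\<And>v. v d \<noteq> 0 \<Longrightarrow> v d' = 0 \<Longrightarrow> ev F (old v) = ev L v"
    using reg by blast
  define c' where "c' = (\<lambda>u. if u = d then 1 else c u)"
  define W where "W l = (\<Sum>u\<in>UNIV - {d}. wt u * Poly_Mapping.lookup l u)" for l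
  \<comment> \<open>Large enough to clear all negative powers of e in L.\<close>
  define N where "N = n + (\<Sum>l\<in>Poly_Mapping.keys L. W l)"
  have W_le: "W l \<le> N" if "l \<in> Poly_Mapping.keys L" for l
    unfolding N_def using member_le_sum[OF that, of W] by simp
  have monomial_value_new: "monomial_value (\<lambda>u. if u = d then e / s else c u / e ^ wt u) l =
      monomial_value c' l * (1 / s) ^ Poly_Mapping.lookup l d * e ^ Poly_Mapping.lookup l d / e ^ W l" for e s l
  proof -
    have "monomial_value c' l = (\<Prod>u\<in>UNIV - {d}. c u ^ Poly_Mapping.lookup l u)"
      by (simp add: monomial_value_def c'_def prod.remove[of UNIV d])
    then show ?thesis
      by (simp add: monomial_value_def prod.remove[of UNIV d] W_def power_divide prod_dividef
          power_mult power_sum)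
  qed
  \<comment> \<open>\<open>P s\<close> and \<open>Q s\<close> are the two sides as polynomials in e, the first one multiplied by the n-th
    power of e and the second one by the N-th.\<close>
  define P where "P s = (\<Sum>m\<in>Poly_Mapping.keys F. smult (Poly_Mapping.lookup F m)
      (monom 1 (n - weight m) * (\<Prod>u\<in>UNIV. b s u ^ Poly_Mapping.lookup m u)))" for s
  define Q where "Q s = (\<Sum>l\<in>Poly_Mapping.keys L.
      monom (Poly_Mapping.lookup L l * monomial_value c' l * (1 / s) ^ Poly_Mapping.lookup l d)
        (N + Poly_Mapping.lookup l d - W l))" for s
  \<comment> \<open>The coefficient of the power N - n of e in \<open>Q s\<close>, as a polynomial in 1 / s.\<close>
  define R where "R = (\<Sum>l\<in>Poly_Mapping.keys L.
      monom (if N + Poly_Mapping.lookup l d - W l = N - n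
        then Poly_Mapping.lookup L l * monomial_value c' l else 0) (Poly_Mapping.lookup l d))"
  define G where "G = (\<Sum>m\<in>Poly_Mapping.keys F.
      smult (if weight m = n then Poly_Mapping.lookup F m else 0)
        (\<Prod>u\<in>UNIV. \<beta> u ^ Poly_Mapping.lookup m u))"
  have P: "e ^ n * ev F (\<lambda>u. poly (b s u) e / e ^ wt u) = poly (P s) e" if "e \<noteq> 0" for e s
  proof -
    have "e ^ n * (x * (y / e ^ weight m)) = x * (e ^ (n - weight m) * y)"
      if "m \<in> Poly_Mapping.keys F" for m x y
    proof -
      have "e ^ n = e ^ (n - weight m) * e ^ weight m"
        using le that by (simp add: weight_le_def flip: power_add)
      then show ?thesis using \<open>e \<noteq> 0\<close> by simp
    qed
    then show ?thesis
      unfolding ev_def P_def monomial_value_divide monomial_value_power_wt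
      by (simp add: sum_distrib_left poly_sum poly_prod poly_monom monomial_value_def)
  qed
  have Q: "e ^ N * ev L (\<lambda>u. if u = d then e / s else c u / e ^ wt u) = poly (Q s) e"
    if "e \<noteq> 0" for e s
  proof -
    have "e ^ N * (x * (y * z * e ^ Poly_Mapping.lookup l d / e ^ W l)) =
        x * y * z * e ^ (N + Poly_Mapping.lookup l d - W l)"
      if "l \<in> Poly_Mapping.keys L" for l x y z
    proof -
      have "e ^ N * e ^ Poly_Mapping.lookup l d =
          e ^ (N + Poly_Mapping.lookup l d - W l) * e ^ W l"
        using W_le[OF that] by (simp flip: power_add)
      then show ?thesis using \<open>e \<noteq> 0\<close> by (simp add: field_simps)
    qed
    then show ?thesis
      unfolding ev_def Q_def monomial_value_new
      by (simp add: sum_distrib_left poly_sum poly_monom)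
  qed
  have PQ: "monom 1 N * P s = monom 1 n * Q s" if "s \<noteq> 0" for s
  proof (rule poly_eqI_off_zero)
    fix e :: ct assume "e \<noteq> 0"
    let ?v = "\<lambda>u. if u = d then e / s else c u / e ^ wt u"
    have "ev F (\<lambda>u. poly (b s u) e / e ^ wt u) = ev L ?v"
      using L[of ?v] old[OF \<open>e \<noteq> 0\<close> \<open>s \<noteq> 0\<close>] \<open>e \<noteq> 0\<close> \<open>s \<noteq> 0\<close> \<open>d' \<noteq> d\<close> \<open>c d' = 0\<close> by auto
    then show "poly (monom 1 N * P s) e = poly (monom 1 n * Q s) e"
      by (simp add: poly_monom flip: P[OF \<open>e \<noteq> 0\<close>] Q[OF \<open>e \<noteq> 0\<close>])
  qed
  have G: "poly G s = ev (weight_part n F) (\<lambda>u. poly (\<beta> u) s)" for s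
    by (simp add: G_def ev_weight_part poly_sum poly_prod monomial_value_def)
  have "poly G s = poly R (1 / s)" if "s \<noteq> 0" for s
  proof -
    have zero: "(0::ct) ^ (n - weight m) = (if weight m = n then 1 else 0)"
      if "m \<in> Poly_Mapping.keys F" for m
      using le that by (auto simp: weight_le_def power_0_left)
    have "poly G s = poly (P s) 0"
      by (auto simp: G_def P_def poly_sum poly_prod poly_monom lead[OF \<open>s \<noteq> 0\<close>] zero
          intro!: sum.cong)
    also have "\<dots> = coeff (monom 1 N * P s) N"
      by (simp add: coeff_monom_mult poly_0_coeff_0)
    also have "\<dots> = coeff (Q s) (N - n)"
      unfolding PQ[OF \<open>s \<noteq> 0\<close>] by (simp add: coeff_monom_mult N_def)
    also have "\<dots> = poly R (1 / s)"
      by (auto simp: Q_def R_def coeff_sum poly_sum poly_monom intro!: sum.cong)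
    finally show ?thesis .
  qed
  then show ?thesis
    using constant_if_polynomial_in_inverse[of G R s] G by metis
qed

section \<open>The four coordinate changes on the hypersurfaces of zero momentum\<close>

text \<open>Polynomiality of F in new coordinates, restricted to the points where the new coordinate d
  is nonzero (it is a denominator) and its momentum \<open>d'\<close> is zero.\<close>

definition pole_free :: "coord \<Rightarrow> coord \<Rightarrow> ((coord \<Rightarrow> ct) \<Rightarrow> coord \<Rightarrow> ct) \<Rightarrow> mpoly \<Rightarrow> bool" where
  "pole_free d d' old F \<longleftrightarrow> (\<exists>L. \<forall>v. v d \<noteq> 0 \<longrightarrow> v d' = 0 \<longrightarrow> ev F (old v) = ev L v)"

lemma pole_free_diff: "pole_free d d' old F \<Longrightarrow> pole_free d d' old G \<Longrightarrow> pole_free d d' old (F - G)"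
  unfolding pole_free_def by (metis ev_diff)

lemma pole_free_mult: "pole_free d d' old F \<Longrightarrow> pole_free d d' old G \<Longrightarrow> pole_free d d' old (F * G)"
  unfolding pole_free_def by (metis ev_mult)

lemma pole_free_Const: "pole_free d d' old (Const c)"
  unfolding pole_free_def by (metis ev_Const)

lemma pole_free_power: "pole_free d d' old F \<Longrightarrow> pole_free d d' old (F ^ n)"
  unfolding pole_free_def by (metis ev_power)

lemma pole_free_if_polynomial:
  assumes "is_polynomial (substitute F e)"
    and "\<And>v u. v d \<noteq> 0 \<Longrightarrow> takes_value (component e u) v (old v u)"
  shows "pole_free d d' old F"
proof -
  obtain L where "substitute F e = to_fract L"
    using assms(1) unfolding is_polynomial_def by blast
  then have "ev F (old v) = ev L v" if "v d \<noteq> 0" for v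
    using takes_value_substitute[of e v "old v" F] assms(2)[of v, OF that] takes_value_to_fract_D
    by metis
  then show ?thesis unfolding pole_free_def by blast
qed

text \<open>The formulas for \<^const>\<open>old_coords\<close>, with values in place of rational functions.\<close>
definition old0 :: "ct \<Rightarrow> (coord \<Rightarrow> ct) \<Rightarrow> coord \<Rightarrow> ct" where
  "old0 a v = component (1 / v cx, - (v cx * v cy + a) * v cx - v cz ^ 2 / 4, v cz,
     v cw - v cz / (2 * v cx), v cq, v cp)"

definition old1 :: "ct \<Rightarrow> (coord \<Rightarrow> ct) \<Rightarrow> coord \<Rightarrow> ct" where
  "old1 a v = component (v cx, v cy, 1 / v cz, - (v cz * v cw + a) * v cz, v cq, v cp)"

definition old2 :: "ct \<Rightarrow> ct \<Rightarrow> (coord \<Rightarrow> ct) \<Rightarrow> coord \<Rightarrow> ct" where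
  "old2 t a v = component (v cx + 1 / (2 * v cz), v cy - 1 / (4 * v cz ^ 2), 1 / v cz,
     - (v cz * v cw + a) * v cz - v cy / 2 - v cp - t - v cx / (2 * v cz) + v cq / (4 * v cz),
     v cq + 1 / v cz, v cp + 1 / (8 * v cz ^ 2))"

definition old3 :: "ct \<Rightarrow> (coord \<Rightarrow> ct) \<Rightarrow> coord \<Rightarrow> ct" where
  "old3 a v = component (v cx, v cy, v cz, v cw, 1 / v cq, - (v cq * v cp + a) * v cq)"

lemmas takes_value_intros =
  takes_value_add takes_value_diff takes_value_mult takes_value_uminus takes_value_divide
  takes_value_power takes_value_rvar takes_value_numeral takes_value_const

lemma pole_free_0:
  "is_polynomial (rewrite_in (r0 (rconst a)) F) \<Longrightarrow> pole_free cx d' (old0 a) F"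
  unfolding rewrite_in_def
proof (erule pole_free_if_polynomial)
  fix v :: "coord \<Rightarrow> ct" and u assume "v cx \<noteq> 0"
  then show "takes_value (component (old_coords (r0 (rconst a))) u) v (old0 a v u)"
    unfolding old_coords_r0 old0_def
    by (cases u) (simp_all only: component.simps, (intro takes_value_intros; simp)+)
qed

lemma pole_free_1:
  "is_polynomial (rewrite_in (r1 (rconst a)) F) \<Longrightarrow> pole_free cz d' (old1 a) F"
  unfolding rewrite_in_def
proof (erule pole_free_if_polynomial)
  fix v :: "coord \<Rightarrow> ct" and u assume "v cz \<noteq> 0"
  then show "takes_value (component (old_coords (r1 (rconst a))) u) v (old1 a v u)"
    unfolding old_coords_r1 old1_def
    by (cases u) (simp_all only: component.simps, (intro takes_value_intros; simp)+)
qed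

lemma pole_free_2:
  "is_polynomial (rewrite_in (r2 (rconst t) (rconst a)) F) \<Longrightarrow> pole_free cz d' (old2 t a) F"
  unfolding rewrite_in_def
proof (erule pole_free_if_polynomial)
  fix v :: "coord \<Rightarrow> ct" and u assume "v cz \<noteq> 0"
  then show "takes_value (component (old_coords (r2 (rconst t) (rconst a))) u) v (old2 t a v u)"
    unfolding old_coords_r2 old2_def
    by (cases u) (simp_all only: component.simps, (intro takes_value_intros; simp)+)
qed

lemma pole_free_3:
  "is_polynomial (rewrite_in (r3 (rconst a)) F) \<Longrightarrow> pole_free cq d' (old3 a) F"
  unfolding rewrite_in_def
proof (erule pole_free_if_polynomial)
  fix v :: "coord \<Rightarrow> ct" and u assume "v cq \<noteq> 0"
  then show "takes_value (component (old_coords (r3 (rconst a))) u) v (old3 a v u)"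
    unfolding old_coords_r3 old3_def
    by (cases u) (simp_all only: component.simps, (intro takes_value_intros; simp)+)
qed

abbreviation at6 :: "mpoly \<Rightarrow> ct \<Rightarrow> ct \<Rightarrow> ct \<Rightarrow> ct \<Rightarrow> ct \<Rightarrow> ct \<Rightarrow> ct" where
  "at6 F x y z w q p \<equiv> ev F (component (x, y, z, w, q, p))"

lemma poly_component:
  "(\<lambda>u. poly (component (f1, f2, f3, f4, f5, f6) u) s) =
    component (poly f1 s, poly f2 s, poly f3 s, poly f4 s, poly f5 s, poly f6 s)"
  by (rule ext, rename_tac u, case_tac u) simp_all

text \<open>On the hypersurface y + z^2/4 = 0 the Hamiltonian flow of y + z^2/4 moves x and shifts w
  by -xz/2. The shift is written on the right-hand side, which keeps the left-hand side simple.\<close>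
lemma leading_part_0:
  assumes "pole_free cx cy (old0 a) F" "weight_le n F"
  shows "at6 (weight_part n F) x (- z\<^sup>2 / 4) z w q p =
    at6 (weight_part n F) 0 (- z\<^sup>2 / 4) z (w + x * z / 2) q p"
proof -
  let ?w = "w + x * z / 2"
  define c where "c = component (0, 0, z, ?w, q, p)"
  define b where "b s = component ([:s:], [:- z\<^sup>2 / 4, 0, 0, - a / s:], [:z:], [:?w - z * s / 2:],
    [:q:], [:p:])" for s
  define \<beta> where "\<beta> = component ([:0, 1:], [:- z\<^sup>2 / 4:], [:z:], [:?w, - z / 2:], [:q:], [:p:])"
  have "ev (weight_part n F) (\<lambda>u. poly (\<beta> u) x) = ev (weight_part n F) (\<lambda>u. poly (\<beta> u) 0)"
  proof (rule leading_part_constant[OF _ _ assms(2)])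
    show "\<exists>L. \<forall>v. v cx \<noteq> 0 \<longrightarrow> v cy = 0 \<longrightarrow> ev F (old0 a v) = ev L v"
      using assms(1) unfolding pole_free_def .
    show "old0 a (\<lambda>u. if u = cx then e / s else c u / e ^ wt u) = (\<lambda>u. poly (b s u) e / e ^ wt u)"
      if "e \<noteq> 0" "s \<noteq> 0" for e s
    proof
      fix u
      show "old0 a (\<lambda>u. if u = cx then e / s else c u / e ^ wt u) u = poly (b s u) e / e ^ wt u"
        using that by (cases u) (simp_all add: old0_def c_def b_def field_simps power2_eq_square)
    qed
    show "poly (b s u) 0 = poly (\<beta> u) s" for s u
      by (cases u) (simp_all add: b_def \<beta>_def)
  qed (simp_all add: c_def)
  then show ?thesis
    unfolding \<beta>_def poly_component by simp
qed

lemma leading_part_1: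
  assumes "pole_free cz cw (old1 a) F" "weight_le n F"
  shows "at6 (weight_part n F) x y z 0 q p = at6 (weight_part n F) x y 0 0 q p"
proof -
  define c where "c = component (x, y, 0, 0, q, p)"
  define b where "b s = component ([:x:], [:y:], [:s:], [:0, 0, 0, - a / s:], [:q:], [:p:])" for s
  define \<beta> where "\<beta> = component ([:x:], [:y:], [:0, 1:], [:0:], [:q:], [:p:])"
  have "ev (weight_part n F) (\<lambda>u. poly (\<beta> u) z) = ev (weight_part n F) (\<lambda>u. poly (\<beta> u) 0)"
  proof (rule leading_part_constant[OF _ _ assms(2)])
    show "\<exists>L. \<forall>v. v cz \<noteq> 0 \<longrightarrow> v cw = 0 \<longrightarrow> ev F (old1 a v) = ev L v"
      using assms(1) unfolding pole_free_def .
    show "old1 a (\<lambda>u. if u = cz then e / s else c u / e ^ wt u) = (\<lambda>u. poly (b s u) e / e ^ wt u)"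
      if "e \<noteq> 0" "s \<noteq> 0" for e s
    proof
      fix u
      show "old1 a (\<lambda>u. if u = cz then e / s else c u / e ^ wt u) u = poly (b s u) e / e ^ wt u"
        using that by (cases u) (simp_all add: old1_def c_def b_def field_simps power2_eq_square)
    qed
    show "poly (b s u) 0 = poly (\<beta> u) s" for s u
      by (cases u) (simp_all add: b_def \<beta>_def)
  qed (simp_all add: c_def)
  then show ?thesis
    unfolding \<beta>_def poly_component by simp
qed

lemma leading_part_3:
  assumes "pole_free cq cp (old3 a) F" "weight_le n F"
  shows "at6 (weight_part n F) x y z w q 0 = at6 (weight_part n F) x y z w 0 0"
proof -
  define c where "c = component (x, y, z, w, 0, 0)"
  define b where "b s = component ([:x:], [:y:], [:z:], [:w:], [:s:], [:0, 0, 0, - a / s:])" for s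
  define \<beta> where "\<beta> = component ([:x:], [:y:], [:z:], [:w:], [:0, 1:], [:0:])"
  have "ev (weight_part n F) (\<lambda>u. poly (\<beta> u) q) = ev (weight_part n F) (\<lambda>u. poly (\<beta> u) 0)"
  proof (rule leading_part_constant[OF _ _ assms(2)])
    show "\<exists>L. \<forall>v. v cq \<noteq> 0 \<longrightarrow> v cp = 0 \<longrightarrow> ev F (old3 a v) = ev L v"
      using assms(1) unfolding pole_free_def .
    show "old3 a (\<lambda>u. if u = cq then e / s else c u / e ^ wt u) = (\<lambda>u. poly (b s u) e / e ^ wt u)"
      if "e \<noteq> 0" "s \<noteq> 0" for e s
    proof
      fix u
      show "old3 a (\<lambda>u. if u = cq then e / s else c u / e ^ wt u) u = poly (b s u) e / e ^ wt u"
        using that by (cases u) (simp_all add: old3_def c_def b_def field_simps power2_eq_square)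
    qed
    show "poly (b s u) 0 = poly (\<beta> u) s" for s u
      by (cases u) (simp_all add: b_def \<beta>_def)
  qed (simp_all add: c_def)
  then show ?thesis
    unfolding \<beta>_def poly_component by simp
qed

text \<open>On the left, the point at time z of the flow of w + y/2 + p + xz/2 - zq/4, on the zero set
  of this function, that starts at z = 0 in the point on the right.\<close>
lemma leading_part_2:
  assumes "pole_free cz cw (old2 t a) F" "weight_le n F"
  shows "at6 (weight_part n F) (x + z / 2) (y - z\<^sup>2 / 4) z (- y / 2 - p - x * z / 2 + z * q / 4)
      (q + z) (p + z\<^sup>2 / 8) =
    at6 (weight_part n F) x y 0 (- y / 2 - p) q p"
proof -
  define c where "c = component (x, y, 0, 0, q, p)"
  define b where "b s = component ([:x + s / 2:], [:y - s\<^sup>2 / 4:], [:s:],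
    [:- y / 2 - p - x * s / 2 + s * q / 4, 0, - t, - a / s:], [:q + s:], [:p + s\<^sup>2 / 8:])" for s
  define \<beta> where "\<beta> = component ([:x, 1 / 2:], [:y, 0, - 1 / 4:], [:0, 1:],
    [:- y / 2 - p, - x / 2 + q / 4:], [:q, 1:], [:p, 0, 1 / 8:])"
  have "ev (weight_part n F) (\<lambda>u. poly (\<beta> u) z) = ev (weight_part n F) (\<lambda>u. poly (\<beta> u) 0)"
  proof (rule leading_part_constant[OF _ _ assms(2)])
    show "\<exists>L. \<forall>v. v cz \<noteq> 0 \<longrightarrow> v cw = 0 \<longrightarrow> ev F (old2 t a v) = ev L v"
      using assms(1) unfolding pole_free_def .
    show "old2 t a (\<lambda>u. if u = cz then e / s else c u / e ^ wt u) = (\<lambda>u. poly (b s u) e / e ^ wt u)"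
      if "e \<noteq> 0" "s \<noteq> 0" for e s
    proof
      fix u
      show "old2 t a (\<lambda>u. if u = cz then e / s else c u / e ^ wt u) u = poly (b s u) e / e ^ wt u"
        using that by (cases u) (simp_all add: old2_def c_def b_def field_simps power2_eq_square)
    qed
    show "poly (b s u) 0 = poly (\<beta> u) s" for s u
      by (cases u) (simp_all add: b_def \<beta>_def field_simps power2_eq_square)
  qed (simp_all add: c_def)
  then show ?thesis
    unfolding \<beta>_def poly_component by (simp add: algebra_simps power2_eq_square)
qed

section \<open>Quartic polynomials in x, y, z, w invariant under the first two flows\<close>

lemma coefficients_unique:
  fixes f g :: "nat \<Rightarrow> 'a::field_char_0"
  assumes "\<And>x. (\<Sum>i\<le>n. f i * x ^ i) = (\<Sum>i\<le>n. g i * x ^ i)" "i \<le> n"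
  shows "f i = g i"
proof -
  let ?p = "\<lambda>f. (\<Sum>i\<le>n. monom (f i) i)"
  have "?p f = ?p g"
    by (rule poly_eqI_off_zero) (simp add: poly_sum poly_monom assms(1))
  then have "coeff (?p f) i = coeff (?p g) i" by simp
  then show ?thesis
    using \<open>i \<le> n\<close> by (simp add: coeff_sum)
qed

text \<open>The sum over l is placed outside of those over j and k, since w is set to zero in one
  condition and separated from y and z in the other.\<close>
definition quartic :: "(nat \<Rightarrow> nat \<Rightarrow> nat \<Rightarrow> nat \<Rightarrow> 'a::field_char_0) \<Rightarrow> 'a \<Rightarrow> 'a \<Rightarrow> 'a \<Rightarrow> 'a \<Rightarrow> 'a" where
  "quartic c x y z w =
    (\<Sum>i\<le>4. (\<Sum>l\<le>4. (\<Sum>j\<le>4. (\<Sum>k\<le>4. c i j k l * z ^ k) * y ^ j) * w ^ l) * x ^ i)"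

lemma atMost_4: "{..4::nat} = {0, 1, 2, 3, 4}"
  by auto

lemma sum_atMost_4: "(\<Sum>i\<le>4. f i) = f 0 + f 1 + f 2 + f 3 + f (4::nat)"
  by (simp add: atMost_4 add.assoc)

lemma quartic_w0:
  fixes c :: "nat \<Rightarrow> nat \<Rightarrow> nat \<Rightarrow> nat \<Rightarrow> 'a::field_char_0"
  assumes "\<And>x y z. quartic c x y z 0 = quartic c x y 0 0" "0 < k" "k \<le> 4" "i \<le> 4" "j \<le> 4"
  shows "c i j k 0 = 0"
proof -
  have 0: "(\<Sum>l\<le>4. f l * 0 ^ l) = f 0" for f :: "nat \<Rightarrow> 'a"
    by (simp add: sum_atMost_4)
  have "(\<Sum>i\<le>4. (\<Sum>j\<le>4. (\<Sum>k\<le>4. c i j k 0 * z ^ k) * y ^ j) * x ^ i) =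
      (\<Sum>i\<le>4. (\<Sum>j\<le>4. c i j 0 0 * y ^ j) * x ^ i)" for x y z
    using assms(1)[of x y z] by (simp only: quartic_def 0)
  from coefficients_unique[OF this \<open>i \<le> 4\<close>]
  have "(\<Sum>j\<le>4. (\<Sum>k\<le>4. c i j k 0 * z ^ k) * y ^ j) = (\<Sum>j\<le>4. c i j 0 0 * y ^ j)" for y z .
  from coefficients_unique[OF this \<open>j \<le> 4\<close>]
  have "(\<Sum>k\<le>4. c i j k 0 * z ^ k) = c i j 0 0" for z .
  then have "(\<Sum>k\<le>4. c i j k 0 * z ^ k) = (\<Sum>k\<le>4. (if k = 0 then c i j 0 0 else 0) * z ^ k)" for z
    by (simp add: sum_atMost_4)
  from coefficients_unique[OF this \<open>k \<le> 4\<close>] \<open>0 < k\<close> show ?thesis by simp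
qed

text \<open>Comparison of the coefficients of x^i w^l after expanding the right-hand side of the hypothesis
  binomially in w and xz/2. What remains, \<open>A i l z\<close>, is still a polynomial in z.\<close>
lemma quartic_f0:
  fixes c :: "nat \<Rightarrow> nat \<Rightarrow> nat \<Rightarrow> nat \<Rightarrow> 'a::field_char_0"
  defines "A \<equiv> \<lambda>i l z. \<Sum>j\<le>4. (\<Sum>k\<le>4. c i j k l * z ^ k) * (- z\<^sup>2 / 4) ^ j"
  assumes eq: "\<And>x z w. quartic c x (- z\<^sup>2 / 4) z w = quartic c 0 (- z\<^sup>2 / 4) z (w + x * z / 2)"
    and "i \<le> 4" "l \<le> 4"
  shows "A i l z = (if i + l \<le> 4 then of_nat ((i + l) choose i) * (z / 2) ^ i * A 0 (i + l) z else 0)"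
    (is "_ = ?R i l")
proof -
  have A: "quartic c x (- z\<^sup>2 / 4) z w = (\<Sum>i\<le>4. (\<Sum>l\<le>4. A i l z * w ^ l) * x ^ i)" for x w
    by (simp only: quartic_def A_def)
  have "(\<Sum>i\<le>4. (\<Sum>l\<le>4. A i l z * w ^ l) * x ^ i) = (\<Sum>i\<le>4. (\<Sum>l\<le>4. ?R i l * w ^ l) * x ^ i)" for x w
  proof -
    have choose: "3 choose 2 = (3::nat)" "4 choose 2 = (6::nat)" "4 choose 3 = (4::nat)"
      by (simp_all add: eval_nat_numeral)
    have Suc: "Suc (Suc 0) = 2" "Suc 2 = 3"
      by simp_all
    have pow: "(w + u) ^ 2 = w ^ 2 + 2 * u * w + u ^ 2"
      "(w + u) ^ 3 = w ^ 3 + 3 * u * w ^ 2 + 3 * u ^ 2 * w + u ^ 3"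
      "(w + u) ^ 4 = w ^ 4 + 4 * u * w ^ 3 + 6 * u ^ 2 * w ^ 2 + 4 * u ^ 3 * w + u ^ 4" for u
      by algebra+
    define h where "h = z / 2"
    have "(\<Sum>i\<le>4. (\<Sum>l\<le>4. A i l z * w ^ l) * x ^ i) = (\<Sum>l\<le>4. A 0 l z * (w + x * h) ^ l)"
      using eq[of x z w] unfolding A h_def by (simp add: sum_atMost_4)
    also have "\<dots> = (\<Sum>i\<le>4. (\<Sum>l\<le>4. ?R i l * w ^ l) * x ^ i)"
      unfolding h_def[symmetric]
      by (simp add: sum_atMost_4 choose Suc pow power_mult_distrib) algebra
    finally show ?thesis .
  qed
  from coefficients_unique[OF this \<open>i \<le> 4\<close>]
  have "(\<Sum>l\<le>4. A i l z * w ^ l) = (\<Sum>l\<le>4. ?R i l * w ^ l)" for w .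
  from coefficients_unique[OF this \<open>l \<le> 4\<close>] show ?thesis .
qed

lemma poly_eqI_all:
  fixes p r :: "'a::field_char_0 poly"
  assumes "\<And>x. poly p x = poly r x"
  shows "p = r"
  using poly_eqI_off_zero assms by blast

lemma coefficients_shift:
  fixes p r :: "'a::field_char_0 poly"
  assumes "\<And>z. poly p z = m * z ^ n * poly r z"
  shows "p = (pCons 0 ^^ n) (smult m r)"
proof (rule poly_eqI_all)
  have "poly ((pCons 0 ^^ n) s) z = z ^ n * poly s z" for s and z :: 'a
    by (induction n) auto
  then show "poly p z = poly ((pCons 0 ^^ n) (smult m r)) z" for z
    by (simp add: assms)
qed

text \<open>The polynomials 1, y, \<open>B = xy - zw/2\<close> and \<open>C = x\<^sup>2y - w\<^sup>2 - xzw\<close> are invariant under both flows,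
  and every multiple of (y + z^2/4) w is trivially so, since it vanishes on both hypersurfaces. In
  degree at most 4 these, their products and these multiples give all solutions. The coefficient of
  (y + z^2/4) wz is corrected because the monomial yzw occurs in yB as well.\<close>
definition normal_form :: "(nat \<Rightarrow> nat \<Rightarrow> nat \<Rightarrow> nat \<Rightarrow> 'a::field_char_0) \<Rightarrow> 'a \<Rightarrow> 'a \<Rightarrow> 'a \<Rightarrow> 'a \<Rightarrow> 'a" where
  "normal_form c x y z w =
    (let B = x * y - z * w / 2; C = x\<^sup>2 * y - w\<^sup>2 - x * z * w
     in c 0 0 0 0 + c 0 1 0 0 * y + c 0 2 0 0 * y ^ 2 + c 0 3 0 0 * y ^ 3 + c 0 4 0 0 * y ^ 4
      + (c 1 1 0 0 + c 1 2 0 0 * y + c 1 3 0 0 * y ^ 2) * B + c 2 1 0 0 * C + c 2 2 0 0 * B ^ 2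
      + (y + z\<^sup>2 / 4) * w *
        (c 0 1 0 1 + c 1 1 0 1 * x + c 0 2 0 1 * y + (c 0 1 1 1 + c 1 2 0 0 / 2) * z + c 0 1 0 2 * w))"

text \<open>By \<open>quartic_f0\<close> every polynomial \<open>A i l\<close> with i > 0 is a multiple of z^i \<open>A 0 (i + l)\<close>. Low
  degrees on the left and the factor z^i on the right make most coefficients vanish.\<close>
lemma quartic_eq_normal_form:
  fixes c :: "nat \<Rightarrow> nat \<Rightarrow> nat \<Rightarrow> nat \<Rightarrow> 'a::field_char_0"
  assumes deg: "\<And>i j k l. 4 < i + j + k + l \<Longrightarrow> c i j k l = 0"
    and F1: "\<And>x y z. quartic c x y z 0 = quartic c x y 0 0"
    and F0: "\<And>x z w. quartic c x (- z\<^sup>2 / 4) z w = quartic c 0 (- z\<^sup>2 / 4) z (w + x * z / 2)"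
  shows "quartic c x y z w = normal_form c x y z w"
proof -
  have w0: "c i j k 0 = 0" if "0 < k" for i j k
    using quartic_w0[OF F1 that] deg[of i j k 0] by (cases "i + j + k + 0 \<le> 4") auto
  define A where "A = (\<lambda>i l z. \<Sum>j\<le>4. (\<Sum>k\<le>4. c i j k l * z ^ k) * (- z\<^sup>2 / 4) ^ j)"
  have rel: "A i l z = of_nat ((i + l) choose i) * (z / 2) ^ i * A 0 (i + l) z" if "i + l \<le> 4" for i l z
    using quartic_f0[OF F0, of i l z] that unfolding A_def by simp
  note expand = A_def sum_atMost_4 deg w0
  have sq: "(- z\<^sup>2 / 4) ^ 2 = z * z * z * z / 16" "(- z\<^sup>2 / 4) ^ 3 = - (z * z * z * z * z * z) / 64"
    "(- z\<^sup>2 / 4) ^ 4 = z * z * z * z * z * z * z * z / 256" for z :: 'a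
    by (simp_all add: eval_nat_numeral)
  note ring = sq power2_eq_square power3_eq_cube power4_eq_xxxx ring_distribs mult_ac add_ac
  have A0: "A 0 1 z = poly [:c 0 0 0 1, c 0 0 1 1, c 0 0 2 1 - c 0 1 0 1 / 4, c 0 0 3 1 - c 0 1 1 1 / 4,
      c 0 2 0 1 / 16 - c 0 1 2 1 / 4, c 0 2 1 1 / 16, - c 0 3 0 1 / 64:] z"
    "A 0 2 z = poly [:c 0 0 0 2, c 0 0 1 2, c 0 0 2 2 - c 0 1 0 2 / 4, - c 0 1 1 2 / 4, c 0 2 0 2 / 16:] z"
    "A 0 3 z = poly [:c 0 0 0 3, c 0 0 1 3, - c 0 1 0 3 / 4:] z"
    "A 0 4 z = poly [:c 0 0 0 4:] z" for z
    by (simp_all add: expand) (simp_all add: ring add_divide_distrib diff_divide_distrib)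
  have Ai0: "A 1 0 z = poly [:c 1 0 0 0, 0, - c 1 1 0 0 / 4, 0, c 1 2 0 0 / 16, 0, - c 1 3 0 0 / 64:] z"
    "A 2 0 z = poly [:c 2 0 0 0, 0, - c 2 1 0 0 / 4, 0, c 2 2 0 0 / 16:] z"
    "A 3 0 z = poly [:c 3 0 0 0, 0, - c 3 1 0 0 / 4:] z"
    "A 4 0 z = poly [:c 4 0 0 0:] z" for z
    by (simp_all add: expand) (simp_all add: ring add_divide_distrib diff_divide_distrib)
  have Ail: "A 1 1 z = poly [:c 1 0 0 1, c 1 0 1 1, c 1 0 2 1 - c 1 1 0 1 / 4, - c 1 1 1 1 / 4, c 1 2 0 1 / 16:] z"
    "A 2 1 z = poly [:c 2 0 0 1, c 2 0 1 1, - c 2 1 0 1 / 4:] z"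
    "A 3 1 z = poly [:c 3 0 0 1:] z"
    "A 1 2 z = poly [:c 1 0 0 2, c 1 0 1 2, - c 1 1 0 2 / 4:] z"
    "A 2 2 z = poly [:c 2 0 0 2:] z"
    "A 1 3 z = poly [:c 1 0 0 3:] z" for z
    by (simp_all add: expand) (simp_all add: ring add_divide_distrib diff_divide_distrib)
  have shift: "A 4 0 z = 1 / 16 * z ^ 4 * A 0 4 z" "A 3 0 z = 1 / 8 * z ^ 3 * A 0 3 z"
    "A 2 0 z = 1 / 4 * z ^ 2 * A 0 2 z" "A 1 0 z = 1 / 2 * z ^ 1 * A 0 1 z" "A 1 1 z = 1 * z ^ 1 * A 0 2 z"
    "A 2 1 z = 3 / 4 * z ^ 2 * A 0 3 z" "A 3 1 z = 1 / 2 * z ^ 3 * A 0 4 z"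
    "A 1 2 z = 3 / 2 * z ^ 1 * A 0 3 z" "A 2 2 z = 3 / 2 * z ^ 2 * A 0 4 z" "A 1 3 z = 2 * z ^ 1 * A 0 4 z" for z
    using rel[of 4 0 z] rel[of 3 0 z] rel[of 2 0 z] rel[of 1 0 z] rel[of 1 1 z] rel[of 2 1 z]
      rel[of 3 1 z] rel[of 1 2 z] rel[of 2 2 z] rel[of 1 3 z]
    by (simp_all add: eval_nat_numeral)
  note compare = shift[unfolded A0 Ai0 Ail, THEN coefficients_shift]
  have 1: "c 0 0 0 4 = 0" "c 4 0 0 0 = 0" "c 3 1 0 0 = 0" "c 3 0 0 0 = 0"
    "c 0 0 0 3 = 0" "c 0 0 1 3 = 0" "c 0 1 0 3 = 0"
    using compare(1,2) by (simp_all add: numeral_eq_Suc)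
  have 2: "c 3 0 0 1 = 0" "c 1 0 0 2 = 0" "c 1 0 1 2 = 0" "c 1 1 0 2 = 0" "c 2 0 0 2 = 0" "c 1 0 0 3 = 0"
    "c 2 0 0 1 = 0" "c 2 0 1 1 = 0" "c 2 1 0 1 = 0"
    using compare(6-10) 1 by (simp_all add: numeral_eq_Suc)
  have 3: "c 2 0 0 0 = 0" "c 0 0 0 2 = - c 2 1 0 0" "c 0 0 1 2 = 0" "c 0 0 2 2 = c 2 2 0 0 / 4 + c 0 1 0 2 / 4"
    "c 0 1 1 2 = 0" "c 0 2 0 2 = 0"
    using compare(3) by (simp_all add: numeral_eq_Suc field_simps)
  have 4: "c 1 0 0 1 = 0" "c 1 0 1 1 = - c 2 1 0 0" "c 1 0 2 1 = c 1 1 0 1 / 4" "c 1 1 1 1 = - c 2 2 0 0" "c 1 2 0 1 = 0"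
    using compare(5) 3 by (simp_all add: numeral_eq_Suc field_simps eq_neg_iff_add_eq_0)
  have 5: "c 1 0 0 0 = 0" "c 0 0 0 1 = 0" "c 0 0 1 1 = - c 1 1 0 0 / 2" "c 0 0 2 1 = c 0 1 0 1 / 4"
    "c 0 0 3 1 = c 1 2 0 0 / 8 + c 0 1 1 1 / 4" "c 0 1 2 1 = c 0 2 0 1 / 4" "c 0 2 1 1 = - c 1 3 0 0 / 2"
    "c 0 3 0 1 = 0"
    using compare(4) by (simp_all add: numeral_eq_Suc field_simps)
  show ?thesis
    unfolding quartic_def normal_form_def Let_def
    by (simp add: sum_atMost_4 deg w0 1 2 3 4 5 1[unfolded One_nat_def] 2[unfolded One_nat_def]
        3[unfolded One_nat_def] 4[unfolded One_nat_def] 5[unfolded One_nat_def]) (simp add: ring add_divide_distrib diff_divide_distrib)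
qed

section \<open>From coefficients in four variables to six variables\<close>

definition expo :: "nat \<Rightarrow> nat \<Rightarrow> nat \<Rightarrow> nat \<Rightarrow> nat \<Rightarrow> nat \<Rightarrow> coord \<Rightarrow>\<^sub>0 nat" where
  "expo i j k l a b = Poly_Mapping.single cx i + Poly_Mapping.single cy j + Poly_Mapping.single cz k
    + Poly_Mapping.single cw l + Poly_Mapping.single cq a + Poly_Mapping.single cp b"

lemma lookup_expo [simp]:
  "Poly_Mapping.lookup (expo i j k l a b) = component (i, j, k, l, a, b)"
proof
  fix u show "Poly_Mapping.lookup (expo i j k l a b) u = component (i, j, k, l, a, b) u"
    by (cases u) (simp_all add: expo_def lookup_add lookup_single)
qed

lemma expo_lookup:
  "expo (Poly_Mapping.lookup m cx) (Poly_Mapping.lookup m cy) (Poly_Mapping.lookup m cz)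
    (Poly_Mapping.lookup m cw) (Poly_Mapping.lookup m cq) (Poly_Mapping.lookup m cp) = m"
proof (rule poly_mapping_eqI, unfold lookup_expo)
  fix u show "component (Poly_Mapping.lookup m cx, Poly_Mapping.lookup m cy, Poly_Mapping.lookup m cz,
      Poly_Mapping.lookup m cw, Poly_Mapping.lookup m cq, Poly_Mapping.lookup m cp) u =
      Poly_Mapping.lookup m u"
    by (cases u) simp_all
qed

definition degree_le :: "nat \<Rightarrow> mpoly \<Rightarrow> bool" where
  "degree_le n F \<longleftrightarrow> (\<forall>m\<in>Poly_Mapping.keys F. (\<Sum>v\<in>UNIV. Poly_Mapping.lookup m v) \<le> n)"

text \<open>The coefficient of q^a p^b x^i y^j z^k w^l: the powers of q and p come first because the
  normal form is applied to the coefficient of each monomial in q and p.\<close>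
definition coeff6 :: "mpoly \<Rightarrow> nat \<Rightarrow> nat \<Rightarrow> nat \<Rightarrow> nat \<Rightarrow> nat \<Rightarrow> nat \<Rightarrow> ct" where
  "coeff6 F a b i j k l = Poly_Mapping.lookup F (expo i j k l a b)"

lemma coeff6_eq_0:
  assumes "degree_le 4 F" "4 < i + j + k + l + a + b"
  shows "coeff6 F a b i j k l = 0"
  using assms(1)[unfolded degree_le_def, rule_format, of "expo i j k l a b"] assms(2)
  by (rule_tac ccontr) (simp add: coeff6_def in_keys_iff UNIV_coord)

lemma at6_eq_quartics:
  assumes "degree_le 4 F"
  shows "at6 F x y z w q p = (\<Sum>a\<le>4. (\<Sum>b\<le>4. quartic (coeff6 F a b) x y z w * p ^ b) * q ^ a)"
proof -
  define I where "I = {..4::nat} \<times> {..4::nat} \<times> {..4::nat} \<times> {..4::nat} \<times> {..4::nat} \<times> {..4::nat}"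
  define f where "f = (\<lambda>(a, b, i, l, j, k). expo i j k l a b)"
  have inj: "inj_on f I"
  proof (rule inj_onI)
    fix s s' assume "f s = f s'"
    then have "Poly_Mapping.lookup (f s) u = Poly_Mapping.lookup (f s') u" for u by simp
    from this[of cx] this[of cy] this[of cz] this[of cw] this[of cq] this[of cp]
    show "s = s'" by (cases s; cases s') (simp add: f_def)
  qed
  have keys: "Poly_Mapping.keys F \<subseteq> f ` I"
  proof
    fix m assume "m \<in> Poly_Mapping.keys F"
    then have "(\<Sum>v\<in>UNIV. Poly_Mapping.lookup m v) \<le> 4"
      using assms by (simp add: degree_le_def)
    then have "m = f (Poly_Mapping.lookup m cq, Poly_Mapping.lookup m cp, Poly_Mapping.lookup m cx,
        Poly_Mapping.lookup m cw, Poly_Mapping.lookup m cy, Poly_Mapping.lookup m cz)"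
      "(Poly_Mapping.lookup m cq, Poly_Mapping.lookup m cp, Poly_Mapping.lookup m cx,
        Poly_Mapping.lookup m cw, Poly_Mapping.lookup m cy, Poly_Mapping.lookup m cz) \<in> I"
      by (simp_all add: f_def expo_lookup I_def UNIV_coord)
    then show "m \<in> f ` I" by blast
  qed
  have "at6 F x y z w q p = (\<Sum>m\<in>f ` I. Poly_Mapping.lookup F m * monomial_value (component (x, y, z, w, q, p)) m)"
    by (rule ev_superset) (use keys in \<open>simp_all add: I_def\<close>)
  also have "\<dots> = (\<Sum>(a, b, i, l, j, k)\<in>I. coeff6 F a b i j k l * (x ^ i * y ^ j * z ^ k * w ^ l * q ^ a * p ^ b))"
    unfolding sum.reindex[OF inj]
    by (rule sum.cong) (auto simp: f_def coeff6_def monomial_value_def UNIV_coord mult_ac)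
  also have "\<dots> = (\<Sum>a\<le>4. (\<Sum>b\<le>4. quartic (coeff6 F a b) x y z w * p ^ b) * q ^ a)"
    unfolding I_def sum.cartesian_product' quartic_def
    by (simp add: sum_distrib_left sum_distrib_right mult_ac)
  finally show ?thesis .
qed

text \<open>The conditions \<open>F0\<close> and \<open>F1\<close> leave q and p alone, so they hold for each coefficient with respect to
  q and p. Condition \<open>F3\<close> removes the monomials with a power of q but none of p.\<close>
lemma at6_eq_normal_forms:
  assumes deg: "degree_le 4 F"
    and F0: "\<And>x z w q p. at6 F x (- z\<^sup>2 / 4) z w q p = at6 F 0 (- z\<^sup>2 / 4) z (w + x * z / 2) q p"
    and F1: "\<And>x y z q p. at6 F x y z 0 q p = at6 F x y 0 0 q p"
    and F3: "\<And>x y z w q. at6 F x y z w q 0 = at6 F x y z w 0 0"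
  shows "at6 F x y z w q p = (\<Sum>a\<le>4. (\<Sum>b\<le>4.
    (if a > 0 \<and> b = 0 then 0 else normal_form (coeff6 F a b) x y z w * p ^ b)) * q ^ a)"
proof -
  note at6 = at6_eq_quartics[OF deg]
  have compare: "quartic (coeff6 F a b) x y z w = quartic (coeff6 F a b) x' y' z' w'"
    if "\<And>q p. at6 F x y z w q p = at6 F x' y' z' w' q p" "a \<le> 4" "b \<le> 4" for a b x y z w x' y' z' w'
  proof -
    have "(\<Sum>b\<le>4. quartic (coeff6 F a b) x y z w * p ^ b) = (\<Sum>b\<le>4. quartic (coeff6 F a b) x' y' z' w' * p ^ b)" for p
      by (rule coefficients_unique[OF _ \<open>a \<le> 4\<close>]) (use that(1) in \<open>simp add: at6\<close>)
    from coefficients_unique[OF this \<open>b \<le> 4\<close>] show ?thesis .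
  qed
  have nf: "quartic (coeff6 F a b) x y z w = normal_form (coeff6 F a b) x y z w" if "a \<le> 4" "b \<le> 4" for a b
    by (rule quartic_eq_normal_form)
      (use compare[OF F1 that] compare[OF F0 that] coeff6_eq_0[OF deg] in auto)
  have q0: "quartic (coeff6 F a 0) x y z w = 0" if "0 < a" "a \<le> 4" for a
  proof -
    have "(\<Sum>a\<le>4. quartic (coeff6 F a 0) x y z w * q ^ a) =
        (\<Sum>a\<le>4. (if a = 0 then quartic (coeff6 F 0 0) x y z w else 0) * q ^ a)" for q
      using F3[of x y z w q] unfolding at6 by (simp add: sum_atMost_4)
    from coefficients_unique[OF this \<open>a \<le> 4\<close>] \<open>0 < a\<close> show ?thesis by simp
  qed
  show ?thesis
    unfolding at6 using nf q0 by (intro sum.cong arg_cong2[where f="(*)"]) auto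
qed

lemma eq_0_if_vanishing_everywhere:
  assumes "degree_le 4 F" "\<And>x y z w q p. at6 F x y z w q p = 0"
  shows "F = 0"
proof (rule poly_mapping_eqI)
  fix m :: "coord \<Rightarrow>\<^sub>0 nat"
  define i j k l a b where e: "i = Poly_Mapping.lookup m cx" "j = Poly_Mapping.lookup m cy"
    "k = Poly_Mapping.lookup m cz" "l = Poly_Mapping.lookup m cw"
    "a = Poly_Mapping.lookup m cq" "b = Poly_Mapping.lookup m cp"
  show "Poly_Mapping.lookup F m = Poly_Mapping.lookup 0 m"
  proof (cases "4 < i + j + k + l + a + b")
    case True
    then show ?thesis
      using coeff6_eq_0[OF assms(1) True] by (simp add: coeff6_def e expo_lookup)
  next
    case False
    then have le: "a \<le> 4" "b \<le> 4" "i \<le> 4" "l \<le> 4" "j \<le> 4" "k \<le> 4" by simp_all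
    have zero: "f s = 0" if "\<And>x. (\<Sum>i\<le>4. f i * x ^ i) = 0" "s \<le> 4" for f :: "nat \<Rightarrow> ct" and s
      using coefficients_unique[of f 4 "\<lambda>_. 0" s] that by simp
    have "quartic (coeff6 F a b) x y z w = 0" for x y z w
      using zero[of "\<lambda>a. \<Sum>b\<le>4. quartic (coeff6 F a b) x y z w * _ ^ b", OF _ le(1)]
        zero[of "\<lambda>b. quartic (coeff6 F a b) x y z w", OF _ le(2)] assms(2)
      unfolding at6_eq_quartics[OF assms(1)] by simp
    then have "(\<Sum>i\<le>4. (\<Sum>l\<le>4. (\<Sum>j\<le>4. (\<Sum>k\<le>4. coeff6 F a b i j k l * z ^ k) * y ^ j) * w ^ l) * x ^ i) = 0"
      for x y z w by (simp only: quartic_def)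
    from zero[OF this le(3)]
    have "(\<Sum>l\<le>4. (\<Sum>j\<le>4. (\<Sum>k\<le>4. coeff6 F a b i j k l * z ^ k) * y ^ j) * w ^ l) = 0" for y z w .
    from zero[OF this le(4)]
    have "(\<Sum>j\<le>4. (\<Sum>k\<le>4. coeff6 F a b i j k l * z ^ k) * y ^ j) = 0" for y z .
    from zero[OF this le(5)]
    have "(\<Sum>k\<le>4. coeff6 F a b i j k l * z ^ k) = 0" for z .
    from zero[OF this le(6)] show ?thesis
      by (simp add: coeff6_def e expo_lookup)
  qed
qed

section \<open>Solving the conditions on the leading part\<close>

text \<open>The condition from the third coordinate change is kept apart: in weight 1 it is
  modified by the term z.\<close>
definition leading_solution :: "nat \<Rightarrow> mpoly \<Rightarrow> bool" where
  "leading_solution n T \<longleftrightarrow> degree_le 4 T \<and> (\<forall>m\<in>Poly_Mapping.keys T. weight m = n) \<and>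
    (\<forall>x z w q p. at6 T x (- z\<^sup>2 / 4) z w q p = at6 T 0 (- z\<^sup>2 / 4) z (w + x * z / 2) q p) \<and>
    (\<forall>x y z q p. at6 T x y z 0 q p = at6 T x y 0 0 q p) \<and>
    (\<forall>x y z w q. at6 T x y z w q 0 = at6 T x y z w 0 0)"

definition invariant_2 :: "mpoly \<Rightarrow> bool" where
  "invariant_2 T \<longleftrightarrow> (\<forall>x y z q p. at6 T (x + z / 2) (y - z\<^sup>2 / 4) z (- y / 2 - p - x * z / 2 + z * q / 4)
      (q + z) (p + z\<^sup>2 / 8) = at6 T x y 0 (- y / 2 - p) q p)"

context
  fixes n T
  assumes sol: "leading_solution n T"
begin

lemma coeff6_weight: "n \<noteq> i + 2 * j + k + 2 * l + a + 2 * b \<Longrightarrow> coeff6 T a b i j k l = 0"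
  using sol[unfolded leading_solution_def, THEN conjunct2, THEN conjunct1, rule_format, of "expo i j k l a b"]
  by (rule_tac ccontr) (simp add: coeff6_def in_keys_iff UNIV_coord weight_def)

lemmas coeff6_degree = coeff6_eq_0[OF sol[unfolded leading_solution_def, THEN conjunct1]]

lemma leading_solution_normal_form:
  "at6 T x y z w q p = (\<Sum>a\<le>4. (\<Sum>b\<le>4.
    (if a > 0 \<and> b = 0 then 0 else normal_form (coeff6 T a b) x y z w * p ^ b)) * q ^ a)"
  using sol unfolding leading_solution_def by (intro at6_eq_normal_forms) blast+

end

lemma invariant_2D: "invariant_2 T \<Longrightarrow> at6 T (x + z / 2) (y - z\<^sup>2 / 4) z (- y / 2 - p - x * z / 2 + z * q / 4)
      (q + z) (p + z\<^sup>2 / 8) = at6 T x y 0 (- y / 2 - p) q p"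
  unfolding invariant_2_def by blast

text \<open>The part of weight 6 of tH.\<close>
definition lead_Ham :: mpoly where
  "lead_Ham =
    (let x = Var cx; y = Var cy; z = Var cz; w = Var cw; q = Var cq; p = Var cp
     in Const (1 / 4) * y ^ 3 + Const (3 / 4) * z ^ 2 * w ^ 2 - 4 * p ^ 3 + Const (3 / 4) *
         (8 * x * y * q * p - 4 * z * w * q * p + 8 * x * z * w * p - 8 * x ^ 2 * y * p
          + 2 * z ^ 2 * w * p + y * z ^ 2 * w
          - 2 * y * q ^ 2 * p + 8 * w ^ 2 * p - 4 * y * p ^ 2 + 4 * y * w ^ 2 + 4 * y ^ 2 * w
          + 8 * y * w * p))"

lemmas expand_normal_form = normal_form_def Let_def sum_atMost_4

text \<open>In each weight n, the normal form leaves few coefficients. The remaining condition is linear in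
  them, and it is evaluated at points with small integer coordinates that were selected such
  that the resulting equations have maximal rank. The arguments of \<open>invariant_2D\<close> are the values of
  x, z, y, p, q, in this order.\<close>
lemma leading_solution_1:
  assumes sol: "leading_solution 1 T"
  shows "at6 T x y z w q p = 0"
proof -
  define c where "c = coeff6 T"
  have T: "at6 T x y z w q p = 0" for x y z w q p
    unfolding leading_solution_normal_form[OF sol]
    by (simp add: expand_normal_form c_def coeff6_weight[OF sol] coeff6_degree[OF sol] algebra_simps)
  show ?thesis unfolding T ..
qed

lemma leading_solution_2:
  assumes sol: "leading_solution 2 T" and inv: "invariant_2 T"
  shows "\<exists>e. \<forall>x y z w q p. at6 T x y z w q p = e * (y + 2 * p) ^ 1"
proof -
  define c where "c = coeff6 T"
  have T: "at6 T x y z w q p = c 0 0 0 1 0 0 * y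
      + c 0 1 0 0 0 0 * p" for x y z w q p
    unfolding leading_solution_normal_form[OF sol]
    by (simp add: expand_normal_form c_def coeff6_weight[OF sol] coeff6_degree[OF sol] algebra_simps)
  have e1: "- 2 * c 0 0 0 1 0 0 + c 0 1 0 0 0 0 = 0"
    using invariant_2D[OF inv, of 0 2 0 0 0] unfolding T by (simp add: field_simps; algebra)
  note eqs = e1
  have coeffs:
    "c 0 1 0 0 0 0 = 2 * c 0 0 0 1 0 0"
    using eqs by algebra+
  have "at6 T x y z w q p = c 0 0 0 1 0 0 * (y + 2 * p) ^ 1" for x y z w q p
    unfolding T coeffs by algebra
  then show ?thesis by blast
qed

lemma leading_solution_3:
  assumes sol: "leading_solution 3 T" and inv: "invariant_2 T"
  shows "at6 T x y z w q p = 0"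
proof -
  define c where "c = coeff6 T"
  have T: "at6 T x y z w q p = c 0 0 1 1 0 0 * (x * y - z * w / 2)
      + c 1 1 0 0 0 0 * q * p" for x y z w q p
    unfolding leading_solution_normal_form[OF sol]
    by (simp add: expand_normal_form c_def coeff6_weight[OF sol] coeff6_degree[OF sol] algebra_simps)
  have e1: "3 * c 1 1 0 0 0 0 = 0"
    using invariant_2D[OF inv, of 0 2 0 1 0] unfolding T by (simp add: field_simps; algebra)
  have e2: "- 3 * c 0 0 1 1 0 0 = 0"
    using invariant_2D[OF inv, of 0 2 0 "-1" 2] unfolding T by (simp add: field_simps; algebra)
  note eqs = e1 e2
  have coeffs:
    "c 0 0 1 1 0 0 = 0"
    "c 1 1 0 0 0 0 = 0"
    using eqs by algebra+
  show ?thesis unfolding T coeffs by simp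
qed

lemma leading_solution_4:
  assumes sol: "leading_solution 4 T" and inv: "invariant_2 T"
  shows "\<exists>e. \<forall>x y z w q p. at6 T x y z w q p = e * (y + 2 * p) ^ 2"
proof -
  define c where "c = coeff6 T"
  have T: "at6 T x y z w q p = c 0 0 0 2 0 0 * y ^ 2
      + c 0 0 2 1 0 0 * (x ^ 2 * y - w ^ 2 - x * z * w)
      + c 0 0 0 1 0 1 * (y + z\<^sup>2 / 4) * w
      + c 0 1 0 1 0 0 * y * p
      + c 0 2 0 0 0 0 * p ^ 2
      + c 2 1 0 0 0 0 * q ^ 2 * p" for x y z w q p
    unfolding leading_solution_normal_form[OF sol]
    by (simp add: expand_normal_form c_def coeff6_weight[OF sol] coeff6_degree[OF sol] algebra_simps)
  have e1: "- 4 * c 0 0 2 1 0 0 + 8 * c 2 1 0 0 0 0 = 0"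
    using invariant_2D[OF inv, of "-1" 4 2 "-1" "-2"] unfolding T by (simp add: field_simps; algebra)
  have e2: "- 4 * c 0 0 0 1 0 1 + 16 * c 2 1 0 0 0 0 = 0"
    using invariant_2D[OF inv, of 1 4 2 "-1" 0] unfolding T by (simp add: field_simps; algebra)
  have e3: "- 4 * c 0 0 0 2 0 0 - 4 * c 0 0 2 1 0 0 + c 0 2 0 0 0 0 = 0"
    using invariant_2D[OF inv, of "-1" 2 1 0 "-2"] unfolding T by (simp add: field_simps; algebra)
  have e4: "4 * c 0 0 0 2 0 0 - 2 * c 0 1 0 1 0 0 + c 0 2 0 0 0 0 = 0"
    using invariant_2D[OF inv, of 0 2 0 0 "-2"] unfolding T by (simp add: field_simps; algebra)
  have e5: "- 4 * c 0 1 0 1 0 0 + 4 * c 0 2 0 0 0 0 + 8 * c 2 1 0 0 0 0 = 0"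
    using invariant_2D[OF inv, of "-1" 4 2 0 "-2"] unfolding T by (simp add: field_simps; algebra)
  note eqs = e1 e2 e3 e4 e5
  have coeffs:
    "c 0 0 2 1 0 0 = 0"
    "c 0 0 0 1 0 1 = 0"
    "c 0 1 0 1 0 0 = 4 * c 0 0 0 2 0 0"
    "c 0 2 0 0 0 0 = 4 * c 0 0 0 2 0 0"
    "c 2 1 0 0 0 0 = 0"
    using eqs by algebra+
  have "at6 T x y z w q p = c 0 0 0 2 0 0 * (y + 2 * p) ^ 2" for x y z w q p
    unfolding T coeffs by algebra
  then show ?thesis by blast
qed

lemma leading_solution_5:
  assumes sol: "leading_solution 5 T" and inv: "invariant_2 T"
  shows "at6 T x y z w q p = 0"
proof -
  define c where "c = coeff6 T"
  have T: "at6 T x y z w q p = c 0 0 1 2 0 0 * (y * (x * y - z * w / 2) + (y + z\<^sup>2 / 4) * w * z / 2)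
      + c 0 0 1 1 0 1 * (y + z\<^sup>2 / 4) * w * x
      + c 0 0 0 1 1 1 * (y + z\<^sup>2 / 4) * w * z
      + c 0 1 1 1 0 0 * (x * y - z * w / 2) * p
      + c 1 1 0 1 0 0 * y * q * p
      + c 1 2 0 0 0 0 * q * p ^ 2
      + c 3 1 0 0 0 0 * q ^ 3 * p" for x y z w q p
    unfolding leading_solution_normal_form[OF sol]
    by (simp add: expand_normal_form c_def coeff6_weight[OF sol] coeff6_degree[OF sol] algebra_simps)
  have e1: "48 * c 0 0 1 2 0 0 = 0"
    using invariant_2D[OF inv, of 0 4 0 "-2" 0] unfolding T by (simp add: field_simps; algebra)
  have e2: "18 * c 0 0 1 2 0 0 - 3 * c 0 1 1 1 0 0 = 0"
    using invariant_2D[OF inv, of 0 2 "-2" 0 "-2"] unfolding T by (simp add: field_simps; algebra)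
  have e3: "3 * c 1 2 0 0 0 0 + 54 * c 3 1 0 0 0 0 = 0"
    using invariant_2D[OF inv, of 0 2 1 0 1] unfolding T by (simp add: field_simps; algebra)
  have e4: "2 * c 0 0 1 2 0 0 - 16 * c 0 0 0 1 1 1 + c 0 1 1 1 0 0 = 0"
    using invariant_2D[OF inv, of "-2" 2 "-2" 0 "-2"] unfolding T by (simp add: field_simps; algebra)
  have e5: "- 4 * c 1 1 0 1 0 0 + 5 * c 1 2 0 0 0 0 - 6 * c 3 1 0 0 0 0 = 0"
    using invariant_2D[OF inv, of 0 2 1 "-1" "-1"] unfolding T by (simp add: field_simps; algebra)
  have e6: "14 * c 0 0 1 2 0 0 - 8 * c 0 0 1 1 0 1 - c 0 1 1 1 0 0 = 0"
    using invariant_2D[OF inv, of "-2" 2 2 0 "-2"] unfolding T by (simp add: field_simps; algebra)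
  have e7: "- 6 * c 1 1 0 1 0 0 + 9 * c 1 2 0 0 0 0 + 24 * c 3 1 0 0 0 0 = 0"
    using invariant_2D[OF inv, of 0 2 0 1 0] unfolding T by (simp add: field_simps; algebra)
  note eqs = e1 e2 e3 e4 e5 e6 e7
  have coeffs:
    "c 0 0 1 2 0 0 = 0"
    "c 0 0 1 1 0 1 = 0"
    "c 0 0 0 1 1 1 = 0"
    "c 0 1 1 1 0 0 = 0"
    "c 1 1 0 1 0 0 = 0"
    "c 1 2 0 0 0 0 = 0"
    "c 3 1 0 0 0 0 = 0"
    using eqs by algebra+
  show ?thesis unfolding T coeffs by simp
qed

lemma leading_solution_6:
  assumes sol: "leading_solution 6 T" and inv: "invariant_2 T"
  shows "\<exists>e s. \<forall>x y z w q p. at6 T x y z w q p = e * (y + 2 * p) ^ 3 + s * at6 lead_Ham x y z w q p"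
proof -
  define c where "c = coeff6 T"
  have T: "at6 T x y z w q p = c 0 0 0 3 0 0 * y ^ 3
      + c 0 0 2 2 0 0 * (x * y - z * w / 2) ^ 2
      + c 0 0 0 2 0 1 * (y + z\<^sup>2 / 4) * w * y
      + c 0 0 0 1 0 2 * (y + z\<^sup>2 / 4) * w * w
      + c 0 1 0 2 0 0 * y ^ 2 * p
      + c 0 1 2 1 0 0 * (x ^ 2 * y - w ^ 2 - x * z * w) * p
      + c 0 1 0 1 0 1 * (y + z\<^sup>2 / 4) * w * p
      + c 0 2 0 1 0 0 * y * p ^ 2
      + c 0 3 0 0 0 0 * p ^ 3
      + c 1 1 1 1 0 0 * (x * y - z * w / 2) * q * p
      + c 2 1 0 1 0 0 * y * q ^ 2 * p
      + c 2 2 0 0 0 0 * q ^ 2 * p ^ 2" for x y z w q p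
    unfolding leading_solution_normal_form[OF sol]
    by (simp add: expand_normal_form c_def coeff6_weight[OF sol] coeff6_degree[OF sol] algebra_simps)
  have e1: "- 8 * c 0 0 0 3 0 0 + 4 * c 0 1 0 2 0 0 - 2 * c 0 2 0 1 0 0 + c 0 3 0 0 0 0 = 0"
    using invariant_2D[OF inv, of 0 2 0 0 "-2"] unfolding T by (simp add: field_simps; algebra)
  have e2: "- 64 * c 0 0 0 3 0 0 + 144 * c 0 0 2 2 0 0 - 8 * c 0 1 2 1 0 0 + 8 * c 0 3 0 0 0 0 = 0"
    using invariant_2D[OF inv, of 0 4 0 "-2" 0] unfolding T by (simp add: field_simps; algebra)
  have e3: "- 8 * c 0 0 0 3 0 0 + 4 * c 0 0 0 2 0 1 - 2 * c 0 0 0 1 0 2 + c 0 3 0 0 0 0 + 18 * c 2 2 0 0 0 0 = 0"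
    using invariant_2D[OF inv, of 0 2 1 0 1] unfolding T by (simp add: field_simps; algebra)
  have e4: "- 64 * c 0 0 0 3 0 0 + 64 * c 0 0 2 2 0 0 - 8 * c 0 1 2 1 0 0 + 8 * c 0 3 0 0 0 0 - 16 * c 2 2 0 0 0 0 = 0"
    using invariant_2D[OF inv, of 0 4 0 "-2" "-2"] unfolding T by (simp add: field_simps; algebra)
  have e5: "- 64 * c 0 0 0 3 0 0 + 100 * c 0 0 2 2 0 0 - 8 * c 0 1 2 1 0 0 + 8 * c 0 3 0 0 0 0 - 4 * c 2 2 0 0 0 0 = 0"
    using invariant_2D[OF inv, of 0 4 0 "-2" "-1"] unfolding T by (simp add: field_simps; algebra)
  have e6: "- 8 * c 0 0 0 3 0 0 - 6 * c 0 0 2 2 0 0 + 4 * c 0 0 0 2 0 1 - c 0 1 2 1 0 0 - 2 * c 0 1 0 1 0 1 + c 0 3 0 0 0 0 = 0"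
    using invariant_2D[OF inv, of "-1" 2 1 0 "-2"] unfolding T by (simp add: field_simps; algebra)
  have e7: "- 8 * c 0 0 0 3 0 0 - 30 * c 0 0 2 2 0 0 + 4 * c 0 0 0 2 0 1 + 3 * c 0 1 2 1 0 0 + 2 * c 0 1 0 1 0 1 + c 0 3 0 0 0 0 = 0"
    using invariant_2D[OF inv, of "-2" 2 1 0 "-2"] unfolding T by (simp add: field_simps; algebra)
  have e8: "- 8 * c 0 0 0 3 0 0 + 8 * c 0 0 2 2 0 0 - 4 * c 0 1 0 2 0 0 - 4 * c 0 1 2 1 0 0 - 2 * c 0 2 0 1 0 0 + 7 * c 0 3 0 0 0 0 - 32 * c 2 2 0 0 0 0 = 0"
    using invariant_2D[OF inv, of 0 2 0 "-1" "-2"] unfolding T by (simp add: field_simps; algebra)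
  have e9: "- 8 * c 0 0 0 3 0 0 + 4 * c 0 0 0 2 0 1 + 30 * c 0 0 0 1 0 2 + 8 * c 0 1 0 1 0 1 + c 0 3 0 0 0 0 - 24 * c 1 1 1 1 0 0 + 18 * c 2 2 0 0 0 0 = 0"
    using invariant_2D[OF inv, of "-2" 2 1 0 1] unfolding T by (simp add: field_simps; algebra)
  have e10: "- 8 * c 0 0 0 3 0 0 + 12 * c 0 1 0 2 0 0 + 8 * c 0 1 2 1 0 0 - 18 * c 0 2 0 1 0 0 + 19 * c 0 3 0 0 0 0 - 48 * c 2 1 0 1 0 0 + 72 * c 2 2 0 0 0 0 = 0"
    using invariant_2D[OF inv, of 0 2 0 1 0] unfolding T by (simp add: field_simps; algebra)
  note eqs = e1 e2 e3 e4 e5 e6 e7 e8 e9 e10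
  \<comment> \<open>Two free parameters remain; the monomials y^2 p and ywp separate them, as the first one
    does not occur in \<open>lead_Ham\<close> and the second one not in (y + 2p)^3.\<close>
  define e s where "e = c 0 1 0 2 0 0 / 6" and "s = c 0 1 0 1 0 1 / 6"
  have es: "c 0 1 0 2 0 0 = 6 * e" "c 0 1 0 1 0 1 = 6 * s"
    by (simp_all add: e_def s_def)
  have coeffs:
    "c 0 0 0 3 0 0 = e + s / 4"
    "c 0 0 2 2 0 0 = 0"
    "c 0 0 0 2 0 1 = 3 * s"
    "c 0 0 0 1 0 2 = 3 * s"
    "c 0 1 2 1 0 0 = - 6 * s"
    "c 0 2 0 1 0 0 = 12 * e - 3 * s"
    "c 0 3 0 0 0 0 = 8 * e - 4 * s"
    "c 1 1 1 1 0 0 = 6 * s"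
    "c 2 1 0 1 0 0 = - 3 * s / 2"
    "c 2 2 0 0 0 0 = 0"
    using eqs es by algebra+
  have "at6 T x y z w q p = e * (y + 2 * p) ^ 3 + s * at6 lead_Ham x y z w q p" for x y z w q p
    unfolding T coeffs es by (simp add: lead_Ham_def Let_def field_simps; algebra)
  then show ?thesis by blast
qed

lemma leading_solution_7:
  assumes sol: "leading_solution 7 T" and inv: "invariant_2 T"
  shows "at6 T x y z w q p = 0"
proof -
  define c where "c = coeff6 T"
  have T: "at6 T x y z w q p = c 0 0 1 3 0 0 * y ^ 2 * (x * y - z * w / 2)
      + c 0 1 1 2 0 0 * (y * (x * y - z * w / 2) + (y + z\<^sup>2 / 4) * w * z / 2) * p
      + c 0 1 1 1 0 1 * (y + z\<^sup>2 / 4) * w * x * p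
      + c 0 1 0 1 1 1 * (y + z\<^sup>2 / 4) * w * z * p
      + c 0 2 1 1 0 0 * (x * y - z * w / 2) * p ^ 2
      + c 1 1 0 2 0 0 * y ^ 2 * q * p
      + c 1 1 0 1 0 1 * (y + z\<^sup>2 / 4) * w * q * p
      + c 1 2 0 1 0 0 * y * q * p ^ 2
      + c 1 3 0 0 0 0 * q * p ^ 3" for x y z w q p
    unfolding leading_solution_normal_form[OF sol]
    by (simp add: expand_normal_form c_def coeff6_weight[OF sol] coeff6_degree[OF sol] algebra_simps)
  have e1: "3 * c 1 3 0 0 0 0 = 0"
    using invariant_2D[OF inv, of 0 2 1 0 1] unfolding T by (simp add: field_simps; algebra)
  have e2: "- 24 * c 0 0 1 3 0 0 = 0"
    using invariant_2D[OF inv, of 0 4 2 "-2" 0] unfolding T by (simp add: field_simps; algebra)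
  have e3: "60 * c 0 0 1 3 0 0 - 2 * c 0 1 1 2 0 0 - c 0 2 1 1 0 0 = 0"
    using invariant_2D[OF inv, of "-2" 2 2 0 "-2"] unfolding T by (simp add: field_simps; algebra)
  have e4: "8 * c 0 1 1 2 0 0 + 16 * c 0 1 0 1 1 1 + 8 * c 1 1 0 1 0 1 = 0"
    using invariant_2D[OF inv, of "-2" 4 2 "-1" "-2"] unfolding T by (simp add: field_simps; algebra)
  have e5: "12 * c 1 1 0 2 0 0 - 18 * c 1 2 0 1 0 0 + 27 * c 1 3 0 0 0 0 = 0"
    using invariant_2D[OF inv, of 0 2 0 1 0] unfolding T by (simp add: field_simps; algebra)
  have e6: "- 108 * c 0 0 1 3 0 0 + 18 * c 0 1 1 2 0 0 - 3 * c 0 2 1 1 0 0 = 0"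
    using invariant_2D[OF inv, of 0 2 "-2" 0 "-2"] unfolding T by (simp add: field_simps; algebra)
  have e7: "20 * c 1 1 0 2 0 0 - 50 * c 1 2 0 1 0 0 + 93 * c 1 3 0 0 0 0 = 0"
    using invariant_2D[OF inv, of 0 2 0 2 2] unfolding T by (simp add: field_simps; algebra)
  have e8: "8 * c 0 0 1 3 0 0 - 2 * c 0 1 1 2 0 0 - 4 * c 0 1 0 1 1 1 + c 0 2 1 1 0 0 = 0"
    using invariant_2D[OF inv, of "-1" 2 1 0 "-2"] unfolding T by (simp add: field_simps; algebra)
  have e9: "- 6 * c 0 1 1 2 0 0 - 6 * c 0 1 1 1 0 1 - 12 * c 0 1 0 1 1 1 + 3 * c 0 2 1 1 0 0 = 0"
    using invariant_2D[OF inv, of 0 2 1 0 "-2"] unfolding T by (simp add: field_simps; algebra)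
  note eqs = e1 e2 e3 e4 e5 e6 e7 e8 e9
  have coeffs:
    "c 0 0 1 3 0 0 = 0"
    "c 0 1 1 2 0 0 = 0"
    "c 0 1 1 1 0 1 = 0"
    "c 0 1 0 1 1 1 = 0"
    "c 0 2 1 1 0 0 = 0"
    "c 1 1 0 2 0 0 = 0"
    "c 1 1 0 1 0 1 = 0"
    "c 1 2 0 1 0 0 = 0"
    "c 1 3 0 0 0 0 = 0"
    using eqs by algebra+
  show ?thesis unfolding T coeffs by simp
qed

lemma leading_solution_8:
  assumes sol: "leading_solution 8 T" and inv: "invariant_2 T"
  shows "\<exists>e. \<forall>x y z w q p. at6 T x y z w q p = e * (y + 2 * p) ^ 4"
proof -
  define c where "c = coeff6 T"
  have T: "at6 T x y z w q p = c 0 0 0 4 0 0 * y ^ 4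
      + c 0 1 0 3 0 0 * y ^ 3 * p
      + c 0 1 0 2 0 1 * (y + z\<^sup>2 / 4) * w * y * p
      + c 0 1 0 1 0 2 * (y + z\<^sup>2 / 4) * w * w * p
      + c 0 2 0 2 0 0 * y ^ 2 * p ^ 2
      + c 0 2 0 1 0 1 * (y + z\<^sup>2 / 4) * w * p ^ 2
      + c 0 3 0 1 0 0 * y * p ^ 3
      + c 0 4 0 0 0 0 * p ^ 4" for x y z w q p
    unfolding leading_solution_normal_form[OF sol]
    by (simp add: expand_normal_form c_def coeff6_weight[OF sol] coeff6_degree[OF sol] algebra_simps)
  have e1: "- 16 * c 0 0 0 4 0 0 + c 0 4 0 0 0 0 = 0"
    using invariant_2D[OF inv, of 0 2 1 0 1] unfolding T by (simp add: field_simps; algebra)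
  have e2: "- 4 * c 0 1 0 2 0 1 + 2 * c 0 1 0 1 0 2 + 2 * c 0 2 0 1 0 1 = 0"
    using invariant_2D[OF inv, of 0 4 2 "-1" 1] unfolding T by (simp add: field_simps; algebra)
  have e3: "4 * c 0 1 0 2 0 1 + 2 * c 0 1 0 1 0 2 - 2 * c 0 2 0 1 0 1 = 0"
    using invariant_2D[OF inv, of 0 4 2 "-1" "-1"] unfolding T by (simp add: field_simps; algebra)
  have e4: "- 16 * c 0 0 0 4 0 0 + 32 * c 0 1 0 1 0 2 - 8 * c 0 2 0 1 0 1 + c 0 4 0 0 0 0 = 0"
    using invariant_2D[OF inv, of 1 2 1 0 "-1"] unfolding T by (simp add: field_simps; algebra)
  have e5: "- 16 * c 0 1 0 3 0 0 + 16 * c 0 2 0 2 0 0 - 16 * c 0 3 0 1 0 0 + 16 * c 0 4 0 0 0 0 = 0"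
    using invariant_2D[OF inv, of 0 4 2 0 1] unfolding T by (simp add: field_simps; algebra)
  have e6: "256 * c 0 0 0 4 0 0 - 64 * c 0 1 0 3 0 0 + 16 * c 0 2 0 2 0 0 - 4 * c 0 3 0 1 0 0 = 0"
    using invariant_2D[OF inv, of 0 4 0 "-1" 0] unfolding T by (simp add: field_simps; algebra)
  have e7: "16 * c 0 0 0 4 0 0 - 8 * c 0 1 0 3 0 0 + 4 * c 0 2 0 2 0 0 - 2 * c 0 3 0 1 0 0 + c 0 4 0 0 0 0 = 0"
    using invariant_2D[OF inv, of 0 2 0 0 0] unfolding T by (simp add: field_simps; algebra)
  note eqs = e1 e2 e3 e4 e5 e6 e7
  have coeffs:
    "c 0 1 0 3 0 0 = 8 * c 0 0 0 4 0 0"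
    "c 0 1 0 2 0 1 = 0"
    "c 0 1 0 1 0 2 = 0"
    "c 0 2 0 2 0 0 = 24 * c 0 0 0 4 0 0"
    "c 0 2 0 1 0 1 = 0"
    "c 0 3 0 1 0 0 = 32 * c 0 0 0 4 0 0"
    "c 0 4 0 0 0 0 = 16 * c 0 0 0 4 0 0"
    using eqs by algebra+
  have "at6 T x y z w q p = c 0 0 0 4 0 0 * (y + 2 * p) ^ 4" for x y z w q p
    unfolding T coeffs by algebra
  then show ?thesis by blast
qed

section \<open>The Hamiltonian H satisfies the conditions\<close>

text \<open>The polynomial 4tH, over an arbitrary ring: it is needed both for values and for polynomials.\<close>

definition scaled_Ham :: "'a::comm_ring_1 \<Rightarrow> 'a \<Rightarrow> 'a \<Rightarrow> 'a \<Rightarrow> 'a \<Rightarrow> 'a \<Rightarrow> 'a \<Rightarrow> 'a \<Rightarrow> 'a \<Rightarrow> 'a \<Rightarrow> 'a" where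
  "scaled_Ham x y z w q p t a1 a2 a3 =
    y ^ 3 + 6 * t * y ^ 2 + 4 * (3 * a3 - 1) * x * y + 3 * z ^ 2 * w ^ 2 + 6 * t * z ^ 2 * w
     + 2 * (3 * a1 + 3 * a2 - 2) * z * w + 6 * t * a1 * z - 16 * p ^ 3 - 24 * t * p ^ 2
     - 4 * (3 * a1 + 3 * a2 + 3 * a3 - 2) * q * p - 24 * t ^ 2 * p
     + 3 * a1 * (8 * x * p + 2 * z * p + y * z) + 24 * a2 * x * p + 6 * a3 * (4 * x * p - y * q)
     + 3 * (8 * x * y * q * p - 4 * z * w * q * p + 8 * x * z * w * p - 8 * x ^ 2 * y * p
       + 2 * z ^ 2 * w * p + y * z ^ 2 * w - 2 * y * q ^ 2 * p + 8 * w ^ 2 * p - 4 * y * p ^ 2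
       + 4 * y * w ^ 2 + 4 * y ^ 2 * w + 8 * y * w * p - 8 * x * p + 8 * t * y * w)"

text \<open>The polynomials \<open>scaled_Ham_0\<close> to \<open>scaled_Ham_3\<close> are what 4tH, or 4t(H - z) for the
  coordinates \<open>r\<^sub>2\<close>, becomes in the new coordinates when the new momentum is zero; capital letters
  stand for inverses. To have integer coefficients only, z and y are replaced by suitable
  multiples: the old z is 2z for \<open>r\<^sub>0\<close> and 4z for \<open>r\<^sub>2\<close>, and the new y for \<open>r\<^sub>2\<close> is 2y.\<close>
definition scaled_Ham_0 :: "'a::comm_ring_1 \<Rightarrow> 'a \<Rightarrow> 'a \<Rightarrow> 'a \<Rightarrow> 'a \<Rightarrow> 'a \<Rightarrow> 'a \<Rightarrow> 'a \<Rightarrow> 'a \<Rightarrow> 'a" where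
  "scaled_Ham_0 X z w q p t a0 a2 a3 =
    12 * X ^ 2 * w * a0 ^ 2 + 6 * X ^ 2 * t * a0 ^ 2 + 12 * X * z ^ 2 * w * a0
     + 12 * X * z ^ 2 * t * a0 + 6 * X * z * a0 * a2 + 6 * X * z * a0 * a3
     + 6 * X * q ^ 2 * p * a0 + 6 * X * q * a0 * a3 + 12 * X * p ^ 2 * a0
     + 6 * z ^ 4 * t + 6 * z ^ 3 * a2 + 6 * z ^ 3 * a3 + 6 * z ^ 2 * q ^ 2 * p
     + 6 * z ^ 2 * q * a3 + 12 * z ^ 2 * p ^ 2 + 12 * z * w * a0 + 4 * z * w
     + 12 * z * p * a0 + 12 * z * p + 12 * z * t * a0 + 12 * z * t + 24 * w ^ 2 * p
     + 4 * a0 - X ^ 3 * a0 ^ 3 - 3 * X ^ 2 * z ^ 2 * a0 ^ 2 - 3 * X * z ^ 4 * a0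
     - 6 * X * z * a0 ^ 2 - 6 * X * z * a0 - 12 * X * w ^ 2 * a0 - 24 * X * w * p * a0
     - 24 * X * w * t * a0 - z ^ 6 - 6 * z ^ 3 * a0 - 6 * z ^ 3 - 24 * z * w * q * p
     - 12 * z * w * a3 - 12 * z * p * a2 - 12 * z * p * a3 - 12 * z * t * a2
     - 12 * z * t * a3 - 12 * q * p * a0 - 4 * q * p - 16 * p ^ 3 - 24 * p ^ 2 * t
     - 24 * p * t ^ 2 - 12 * a0 * a3"

lemma scaled_Ham_old0:
  fixes x X z w q p :: "'a::field_char_0"
  assumes "x * X = 1" "a0 + a1 + a2 + a3 = 1"
  shows "scaled_Ham x (- a0 * X - z ^ 2) (2 * z) (w - x * z) q p t a1 a2 a3 =
    scaled_Ham_0 X z w q p t a0 a2 a3"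
  using assms unfolding scaled_Ham_def scaled_Ham_0_def by algebra

definition scaled_Ham_1 :: "'a::comm_ring_1 \<Rightarrow> 'a \<Rightarrow> 'a \<Rightarrow> 'a \<Rightarrow> 'a \<Rightarrow> 'a \<Rightarrow> 'a \<Rightarrow> 'a \<Rightarrow> 'a \<Rightarrow> 'a" where
  "scaled_Ham_1 x y Z q p t a1 a2 a3 =
    24 * x * y * q * p + 12 * x * y * a3 + 24 * x * p * a2 + 24 * x * p * a3 + y ^ 3
     + 6 * y ^ 2 * t + 12 * y * Z ^ 2 * a1 ^ 2 + 24 * Z ^ 2 * p * a1 ^ 2 + 8 * q * p
     + 4 * a1 - 24 * x ^ 2 * y * p - 4 * x * y - 24 * x * p - 12 * y ^ 2 * Z * a1
     - 24 * y * Z * p * a1 - 24 * y * Z * t * a1 - 6 * y * q ^ 2 * p - 6 * y * q * a3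
     - 12 * y * p ^ 2 - 12 * q * p * a2 - 12 * q * p * a3 - 16 * p ^ 3 - 24 * p ^ 2 * t
     - 24 * p * t ^ 2 - 3 * a1 ^ 2 - 6 * a1 * a2"

lemma scaled_Ham_old1:
  fixes x y z Z q p :: "'a::field_char_0"
  assumes "z * Z = 1"
  shows "scaled_Ham x y z (- a1 * Z) q p t a1 a2 a3 =
    scaled_Ham_1 x y Z q p t a1 a2 a3"
  using assms unfolding scaled_Ham_def scaled_Ham_1_def by algebra

definition scaled_Ham_2 :: "'a::comm_ring_1 \<Rightarrow> 'a \<Rightarrow> 'a \<Rightarrow> 'a \<Rightarrow> 'a \<Rightarrow> 'a \<Rightarrow> 'a \<Rightarrow> 'a \<Rightarrow> 'a \<Rightarrow> 'a" where
  "scaled_Ham_2 x y Z q p t a1 a2 a3 =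
    24 * x * (2 * y) * q * p + 12 * x * (2 * y) * a2 + 12 * x * (2 * y) * a3
     + 24 * x * p * a1 + 24 * x * p * a2 + 24 * x * p * a3
     + 12 * (2 * y) * Z ^ 2 * a2 ^ 2 + 24 * (2 * y) * Z * p * a2
     + 24 * Z ^ 2 * p * a2 ^ 2 + 48 * Z * p ^ 2 * a2 + 48 * Z * p * t * a2 + 8 * q * p
     + 8 * p ^ 3 + 24 * p ^ 2 * t + 4 * a2 - 24 * x ^ 2 * (2 * y) * p - 4 * x * (2 * y)
     - 24 * x * p - 2 * (2 * y) ^ 3 - 6 * (2 * y) ^ 2 * p - 6 * (2 * y) ^ 2 * t
     - 6 * (2 * y) * q ^ 2 * p - 6 * (2 * y) * q * a2 - 6 * (2 * y) * q * a3
     - 12 * (2 * y) * t ^ 2 - 12 * q * p * a1 - 12 * q * p * a2 - 12 * q * p * a3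
     - 6 * a1 * a2 - 3 * a2 ^ 2"

lemma scaled_Ham_old2:
  fixes x y z Z q p :: "'a::field_char_0"
  assumes "4 * z * Z = 1"
  shows "scaled_Ham (x + 2 * z) (2 * y - 4 * z ^ 2) (4 * z) (- a2 * Z - y - p - t - 2 * x * z + q * z)
      (q + 4 * z) (p + 2 * z ^ 2) t a1 a2 a3 - 16 * t * z =
    scaled_Ham_2 x y Z q p t a1 a2 a3"
  using assms unfolding scaled_Ham_def scaled_Ham_2_def by algebra

definition scaled_Ham_3 :: "'a::comm_ring_1 \<Rightarrow> 'a \<Rightarrow> 'a \<Rightarrow> 'a \<Rightarrow> 'a \<Rightarrow> 'a \<Rightarrow> 'a \<Rightarrow> 'a \<Rightarrow> 'a \<Rightarrow> 'a" where
  "scaled_Ham_3 x y z w Q t a1 a2 a3 =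
    24 * x ^ 2 * y * Q * a3 - 12 * x * y * a3 - 4 * x * y - 24 * x * z * w * Q * a3
     - 24 * x * Q * a1 * a3 - 24 * x * Q * a2 * a3 - 24 * x * Q * a3 ^ 2
     + 24 * x * Q * a3 + y ^ 3 + 12 * y ^ 2 * w + 6 * y ^ 2 * t + 3 * y * z ^ 2 * w
     + 3 * y * z * a1 + 12 * y * w ^ 2 - 24 * y * w * Q * a3 + 24 * y * w * t
     - 12 * y * Q ^ 2 * a3 ^ 2 + 3 * z ^ 2 * w ^ 2 - 6 * z ^ 2 * w * Q * a3
     + 6 * z ^ 2 * w * t + 6 * z * w * a1 + 6 * z * w * a2 + 12 * z * w * a3
     - 4 * z * w - 6 * z * Q * a1 * a3 + 6 * z * t * a1 - 24 * w ^ 2 * Q * a3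
     + 16 * Q ^ 3 * a3 ^ 3 - 24 * Q ^ 2 * t * a3 ^ 2 + 24 * Q * t ^ 2 * a3
     + 12 * a1 * a3 + 12 * a2 * a3 + 12 * a3 ^ 2 - 8 * a3"

lemma scaled_Ham_old3:
  fixes x y z w q Q :: "'a::field_char_0"
  assumes "q * Q = 1"
  shows "scaled_Ham x y z w q (- a3 * Q) t a1 a2 a3 =
    scaled_Ham_3 x y z w Q t a1 a2 a3"
  using assms unfolding scaled_Ham_def scaled_Ham_3_def by algebra

lemma tvar_nonzero: "tvar \<noteq> 0"
  by (simp add: tvar_def)

lemma ev_Ham:
  "4 * tvar * ev (Ham \<alpha>1 \<alpha>2 \<alpha>3) v =
    scaled_Ham (v cx) (v cy) (v cz) (v cw) (v cq) (v cp) tvar (scal \<alpha>1) (scal \<alpha>2) (scal \<alpha>3)"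
proof -
  define \<tau> where "\<tau> = 1 / tvar"
  have \<tau>: "tvar * \<tau> = 1"
    using tvar_nonzero by (simp add: \<tau>_def)
  have div: "c / tvar = c * \<tau>" "c / (4 * tvar) = c * \<tau> / 4" "c / (2 * tvar) = c * \<tau> / 2" for c
    by (simp_all add: \<tau>_def)
  show ?thesis
    unfolding Ham_def Let_def ev_add ev_diff ev_mult ev_power ev_Const ev_Var ev_numeral div scaled_Ham_def
    using \<tau> by algebra
qed

lemma pole_free_Ham_0:
  assumes "\<alpha>0 + \<alpha>1 + \<alpha>2 + \<alpha>3 = 1"
  shows "pole_free cx cy (old0 (scal \<alpha>0)) (Ham \<alpha>1 \<alpha>2 \<alpha>3)"
proof -
  have sum: "scal \<alpha>0 + scal \<alpha>1 + scal \<alpha>2 + scal \<alpha>3 = 1"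
    unfolding scal_def using assms by (simp flip: to_fract_add add: pCons_one)
  define L where "L = Const (1 / (4 * tvar)) * scaled_Ham_0 (Var cx) (Const (1 / 2) * Var cz) (Var cw) (Var cq) (Var cp)
    (Const tvar) (Const (scal \<alpha>0)) (Const (scal \<alpha>2)) (Const (scal \<alpha>3))"
  have "ev (Ham \<alpha>1 \<alpha>2 \<alpha>3) (old0 (scal \<alpha>0) v) = ev L v" if "v cx \<noteq> 0" "v cy = 0" for v
  proof -
    have "4 * tvar * ev (Ham \<alpha>1 \<alpha>2 \<alpha>3) (old0 (scal \<alpha>0) v) =
        scaled_Ham_0 (v cx) (1 / 2 * v cz) (v cw) (v cq) (v cp) tvar (scal \<alpha>0) (scal \<alpha>2) (scal \<alpha>3)"
      using scaled_Ham_old0[of "1 / v cx" "v cx", OF _ sum, of "1 / 2 * v cz" "v cw" "v cq" "v cp" tvar] that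
      by (simp add: ev_Ham old0_def power_divide mult.commute[of "v cx" 2])
    moreover have "4 * tvar * ev L v = scaled_Ham_0 (v cx) (1 / 2 * v cz) (v cw) (v cq) (v cp) tvar
        (scal \<alpha>0) (scal \<alpha>2) (scal \<alpha>3)"
      using tvar_nonzero by (simp add: L_def scaled_Ham_0_def)
    ultimately show ?thesis
      using tvar_nonzero by (metis mult_cancel_left mult_eq_0_iff zero_neq_numeral)
  qed
  then show ?thesis unfolding pole_free_def by blast
qed

lemma pole_free_Ham_1: "pole_free cz cw (old1 (scal \<alpha>1)) (Ham \<alpha>1 \<alpha>2 \<alpha>3)"
proof -
  define L where "L = Const (1 / (4 * tvar)) * scaled_Ham_1 (Var cx) (Var cy) (Var cz) (Var cq) (Var cp)
    (Const tvar) (Const (scal \<alpha>1)) (Const (scal \<alpha>2)) (Const (scal \<alpha>3))"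
  have "ev (Ham \<alpha>1 \<alpha>2 \<alpha>3) (old1 (scal \<alpha>1) v) = ev L v" if "v cz \<noteq> 0" "v cw = 0" for v
  proof -
    have "4 * tvar * ev (Ham \<alpha>1 \<alpha>2 \<alpha>3) (old1 (scal \<alpha>1) v) =
        scaled_Ham_1 (v cx) (v cy) (v cz) (v cq) (v cp) tvar (scal \<alpha>1) (scal \<alpha>2) (scal \<alpha>3)"
      using scaled_Ham_old1[of "1 / v cz" "v cz"] that
      by (simp add: ev_Ham old1_def)
    moreover have "4 * tvar * ev L v = scaled_Ham_1 (v cx) (v cy) (v cz) (v cq) (v cp) tvar
        (scal \<alpha>1) (scal \<alpha>2) (scal \<alpha>3)"
      using tvar_nonzero by (simp add: L_def scaled_Ham_1_def)
    ultimately show ?thesis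
      using tvar_nonzero by (metis mult_cancel_left mult_eq_0_iff zero_neq_numeral)
  qed
  then show ?thesis unfolding pole_free_def by blast
qed

lemma pole_free_Ham_2: "pole_free cz cw (old2 tvar (scal \<alpha>2)) (Ham \<alpha>1 \<alpha>2 \<alpha>3 - Var cz)"
proof -
  define L where "L = Const (1 / (4 * tvar)) * scaled_Ham_2 (Var cx) (Const (1 / 2) * Var cy) (Var cz) (Var cq) (Var cp)
    (Const tvar) (Const (scal \<alpha>1)) (Const (scal \<alpha>2)) (Const (scal \<alpha>3))"
  have "ev (Ham \<alpha>1 \<alpha>2 \<alpha>3 - Var cz) (old2 tvar (scal \<alpha>2) v) = ev L v"
    if "v cz \<noteq> 0" "v cw = 0" for v
  proof -
    have "4 * tvar * ev (Ham \<alpha>1 \<alpha>2 \<alpha>3 - Var cz) (old2 tvar (scal \<alpha>2) v) =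
        scaled_Ham_2 (v cx) (1 / 2 * v cy) (v cz) (v cq) (v cp) tvar (scal \<alpha>1) (scal \<alpha>2) (scal \<alpha>3)"
      using scaled_Ham_old2[of "1 / (4 * v cz)" "v cz" "v cx" "1 / 2 * v cy"] that
      by (simp add: ev_Ham old2_def power_divide right_diff_distrib)
    moreover have "4 * tvar * ev L v = scaled_Ham_2 (v cx) (1 / 2 * v cy) (v cz) (v cq) (v cp) tvar
        (scal \<alpha>1) (scal \<alpha>2) (scal \<alpha>3)"
      using tvar_nonzero by (simp add: L_def scaled_Ham_2_def power_divide)
    ultimately show ?thesis
      using tvar_nonzero by (metis mult_cancel_left mult_eq_0_iff zero_neq_numeral)
  qed
  then show ?thesis unfolding pole_free_def by blast
qed

lemma pole_free_Ham_3: "pole_free cq cp (old3 (scal \<alpha>3)) (Ham \<alpha>1 \<alpha>2 \<alpha>3)"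
proof -
  define L where "L = Const (1 / (4 * tvar)) * scaled_Ham_3 (Var cx) (Var cy) (Var cz) (Var cw) (Var cq)
    (Const tvar) (Const (scal \<alpha>1)) (Const (scal \<alpha>2)) (Const (scal \<alpha>3))"
  have "ev (Ham \<alpha>1 \<alpha>2 \<alpha>3) (old3 (scal \<alpha>3) v) = ev L v" if "v cq \<noteq> 0" "v cp = 0" for v
  proof -
    have "4 * tvar * ev (Ham \<alpha>1 \<alpha>2 \<alpha>3) (old3 (scal \<alpha>3) v) =
        scaled_Ham_3 (v cx) (v cy) (v cz) (v cw) (v cq) tvar (scal \<alpha>1) (scal \<alpha>2) (scal \<alpha>3)"
      using scaled_Ham_old3[of "1 / v cq" "v cq"] that
      by (simp add: ev_Ham old3_def)
    moreover have "4 * tvar * ev L v = scaled_Ham_3 (v cx) (v cy) (v cz) (v cw) (v cq) tvar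
        (scal \<alpha>1) (scal \<alpha>2) (scal \<alpha>3)"
      using tvar_nonzero by (simp add: L_def scaled_Ham_3_def)
    ultimately show ?thesis
      using tvar_nonzero by (metis mult_cancel_left mult_eq_0_iff zero_neq_numeral)
  qed
  then show ?thesis unfolding pole_free_def by blast
qed

section \<open>Bounds for degrees and weights\<close>

lemma keys_mult_bounded:
  assumes "\<And>m m'. s (m + m') = s m + s m'"
    and "\<forall>m\<in>Poly_Mapping.keys F. s m \<le> a" "\<forall>m\<in>Poly_Mapping.keys G. s m \<le> b"
  shows "\<forall>m\<in>Poly_Mapping.keys (F * G). s m \<le> (a + b :: nat)"
  using keys_mult[of F G] assms by (fastforce intro: add_mono)

lemma degree_le_mult: "degree_le a F \<Longrightarrow> degree_le b G \<Longrightarrow> degree_le (a + b) (F * G)"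
  unfolding degree_le_def by (rule keys_mult_bounded) (simp_all add: lookup_add sum.distrib)

lemma weight_le_mult: "weight_le a F \<Longrightarrow> weight_le b G \<Longrightarrow> weight_le (a + b) (F * G)"
  unfolding weight_le_def
  by (rule keys_mult_bounded) (simp_all add: weight_def lookup_add sum.distrib distrib_left)

lemma bounded_mono:
  "degree_le a F \<Longrightarrow> a \<le> b \<Longrightarrow> degree_le b F"
  "weight_le a F \<Longrightarrow> a \<le> b \<Longrightarrow> weight_le b F"
  by (auto simp: degree_le_def weight_le_def)

text \<open>The bounds of sums are stated with \<^const>\<open>max\<close> so that resolution can compute the bound of a
  given expression.\<close>
lemma degree_le_add: "degree_le a F \<Longrightarrow> degree_le b G \<Longrightarrow> degree_le (max a b) (F + G)"
  using keys_add[of F G] by (fastforce simp: degree_le_def le_max_iff_disj)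

lemma weight_le_add: "weight_le a F \<Longrightarrow> weight_le b G \<Longrightarrow> weight_le (max a b) (F + G)"
  using keys_add[of F G] by (fastforce simp: weight_le_def le_max_iff_disj)

lemma degree_le_diff: "degree_le a F \<Longrightarrow> degree_le b G \<Longrightarrow> degree_le (max a b) (F - G)"
  using keys_diff[of F G] by (fastforce simp: degree_le_def le_max_iff_disj)

lemma weight_le_diff: "weight_le a F \<Longrightarrow> weight_le b G \<Longrightarrow> weight_le (max a b) (F - G)"
  using keys_diff[of F G] by (fastforce simp: weight_le_def le_max_iff_disj)

lemma bounded_Const: "degree_le 0 (Const c)" "weight_le 0 (Const c)"
  by (simp_all add: Const_def degree_le_def weight_le_def weight_def)

lemma bounded_Var: "degree_le 1 (Var u)" "weight_le (wt u) (Var u)"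
  by (cases u; simp add: Var_def degree_le_def weight_le_def weight_def lookup_single UNIV_coord)+

lemma numeral_eq_Const: "(numeral n :: mpoly) = Const (numeral n)"
  by (simp add: Const_def)

lemma bounded_numeral: "degree_le 0 (numeral n)" "weight_le 0 (numeral n)"
  unfolding numeral_eq_Const by (rule bounded_Const)+

lemma degree_le_power: "degree_le a F \<Longrightarrow> degree_le (k * a) (F ^ k)"
proof (induction k)
  case 0 then show ?case by (simp add: degree_le_def)
next
  case (Suc k) then show ?case using degree_le_mult[of a F "k * a" "F ^ k"] by simp
qed

lemma weight_le_power: "weight_le a F \<Longrightarrow> weight_le (k * a) (F ^ k)"
proof (induction k)
  case 0 then show ?case by (simp add: weight_le_def weight_def)
next
  case (Suc k) then show ?case using weight_le_mult[of a F "k * a" "F ^ k"] by simp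
qed

lemmas degree_le_rules = degree_le_mult degree_le_add degree_le_diff degree_le_power
  bounded_Const(1) bounded_Var(1) bounded_numeral(1)

lemmas weight_le_rules = weight_le_mult weight_le_add weight_le_diff weight_le_power
  bounded_Const(2) bounded_Var(2) bounded_numeral(2)

lemma degree_le_Ham: "degree_le 4 (Ham \<alpha>1 \<alpha>2 \<alpha>3)"
  unfolding Ham_def Let_def by (rule bounded_mono, (rule degree_le_rules)+, simp)

lemma degree_le_lead_Ham: "degree_le 4 lead_Ham"
  unfolding lead_Ham_def Let_def by (rule bounded_mono, (rule degree_le_rules)+, simp)

text \<open>The difference is written down explicitly as R; the equality is checked on values.\<close>
lemma Ham_lower_terms:
  "weight_le 5 (Const tvar * Ham \<alpha>1 \<alpha>2 \<alpha>3 - lead_Ham)"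
proof -
  define R where "R =
    (let x = Var cx; y = Var cy; z = Var cz; w = Var cw; q = Var cq; p = Var cp;
         t = Const tvar; a1 = Const (scal \<alpha>1); a2 = Const (scal \<alpha>2); a3 = Const (scal \<alpha>3);
         one = Const 1
     in Const (1 / 4) * (6 * t * y ^ 2 + 4 * (3 * a3 - one) * x * y + 6 * t * z ^ 2 * w
       + 2 * (3 * a1 + 3 * a2 - 2) * z * w + 6 * t * a1 * z - 24 * t * p ^ 2
       - 4 * (3 * a1 + 3 * a2 + 3 * a3 - 2) * q * p - 24 * t ^ 2 * p
       + 3 * a1 * (8 * x * p + 2 * z * p + y * z) + 24 * a2 * x * p + 6 * a3 * (4 * x * p - y * q)
       + 24 * t * y * w - 24 * x * p))"
  have deg: "degree_le 4 (Const tvar * Ham \<alpha>1 \<alpha>2 \<alpha>3 - lead_Ham - R)"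
    unfolding R_def Let_def
    by (rule bounded_mono, (rule degree_le_Ham degree_le_lead_Ham degree_le_rules)+, simp)
  have "at6 (Const tvar * Ham \<alpha>1 \<alpha>2 \<alpha>3 - lead_Ham - R) x y z w q p = 0" for x y z w q p
  proof -
    have "4 * (tvar * at6 (Ham \<alpha>1 \<alpha>2 \<alpha>3) x y z w q p) - 4 * at6 lead_Ham x y z w q p
        - 4 * at6 R x y z w q p = 0"
      using ev_Ham[of \<alpha>1 \<alpha>2 \<alpha>3 "component (x, y, z, w, q, p)"]
      by (simp add: lead_Ham_def R_def Let_def scaled_Ham_def; algebra)
    then show ?thesis by (simp; algebra)
  qed
  from eq_0_if_vanishing_everywhere[OF deg this]
  have "Const tvar * Ham \<alpha>1 \<alpha>2 \<alpha>3 - lead_Ham = R" by simp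
  moreover have "weight_le 5 R"
    unfolding R_def Let_def by (rule bounded_mono, (rule weight_le_rules)+, simp)
  ultimately show ?thesis by simp
qed

lemma Const_1 [simp]: "Const 1 = 1" and Const_0 [simp]: "Const 0 = 0"
  by (simp_all add: Const_def)

lemma Const_diff: "Const (a - b) = Const a - Const b"
  by (simp add: Const_def single_diff)

lemma Const_mult: "Const (a * b) = Const a * Const b"
  by (simp add: Const_def mult_single)

lemma lookup_Const_mult: "Poly_Mapping.lookup (Const c * F) m = c * Poly_Mapping.lookup F m"
  by (simp add: Const_def flip: mult_map_scale_conv_mult) (simp add: map.rep_eq when_def)

lemma weight_part_diff: "weight_part n (F - G) = weight_part n F - weight_part n G"
  by (rule poly_mapping_eqI) (simp add: lookup_weight_part lookup_minus)

lemma weight_part_Const_mult: "weight_part n (Const c * F) = Const c * weight_part n F"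
  by (rule poly_mapping_eqI) (simp add: lookup_weight_part lookup_Const_mult)

lemma weight_part_Var: "weight_part n (Var u) = (if wt u = n then Var u else 0)"
proof (rule poly_mapping_eqI)
  have "weight (Poly_Mapping.single u 1) = wt u"
    by (cases u) (simp_all add: weight_def lookup_single UNIV_coord)
  then show "Poly_Mapping.lookup (weight_part n (Var u)) m =
      Poly_Mapping.lookup (if wt u = n then Var u else 0) m" for m
    by (auto simp: lookup_weight_part Var_def lookup_single when_def)
qed

lemma weight_le_remove_part:
  assumes "weight_le n F" "0 < n"
  shows "weight_le (n - 1) (F - weight_part n F)"
  unfolding weight_le_def
proof
  fix m assume "m \<in> Poly_Mapping.keys (F - weight_part n F)"
  then have "Poly_Mapping.lookup F m \<noteq> 0" "weight m \<noteq> n"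
    by (auto simp: in_keys_iff lookup_minus lookup_weight_part split: if_splits)
  then have "weight m \<le> n" "weight m \<noteq> n"
    using assms(1) by (auto simp: weight_le_def in_keys_iff)
  then show "weight m \<le> n - 1" by simp
qed

section \<open>Reduction of K by descending weight\<close>

definition y_2p :: mpoly where "y_2p = Var cy + 2 * Var cp"

lemma degree_le_y_2p: "degree_le k (y_2p ^ k)"
  unfolding y_2p_def by (rule bounded_mono, (rule degree_le_rules)+, simp)

lemma pole_free_y_2p:
  "pole_free cx cy (old0 a) y_2p" "pole_free cz cw (old1 a) y_2p"
  "pole_free cz cw (old2 t a) y_2p" "pole_free cq cp (old3 a) y_2p"
proof -
  show "pole_free cx cy (old0 a) y_2p"
    unfolding pole_free_def
    by (rule exI[of _ "2 * Var cp - Const a * Var cx - Const (1 / 4) * Var cz ^ 2"])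
      (simp add: y_2p_def old0_def)
  show "pole_free cz cw (old1 a) y_2p"
    unfolding pole_free_def by (rule exI[of _ y_2p]) (simp add: y_2p_def old1_def)
  show "pole_free cz cw (old2 t a) y_2p"
    unfolding pole_free_def by (rule exI[of _ y_2p]) (simp add: y_2p_def old2_def)
  show "pole_free cq cp (old3 a) y_2p"
    unfolding pole_free_def
    by (rule exI[of _ "Var cy - 2 * Const a * Var cq"]) (simp add: y_2p_def old3_def)
qed

context
  fixes \<alpha>0 \<alpha>1 \<alpha>2 \<alpha>3 :: complex
  assumes sum_1: "\<alpha>0 + \<alpha>1 + \<alpha>2 + \<alpha>3 = 1"
begin

text \<open>The parameter c is what makes the conditions linear: they hold for K with c = 1, for y + 2p with
  c = 0, and for linear combinations with the corresponding combination of the c.\<close>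
definition admissible :: "ct \<Rightarrow> mpoly \<Rightarrow> bool" where
  "admissible c F \<longleftrightarrow> degree_le 4 F \<and> pole_free cx cy (old0 (scal \<alpha>0)) F \<and>
    pole_free cz cw (old1 (scal \<alpha>1)) F \<and>
    pole_free cz cw (old2 tvar (scal \<alpha>2)) (F - Const c * Var cz) \<and>
    pole_free cq cp (old3 (scal \<alpha>3)) F"

lemma admissible_diff:
  assumes F: "admissible c F" and G: "admissible d G"
  shows "admissible (c - k * d) (F - Const k * G)"
proof -
  have shift: "F - Const k * G - Const (c - k * d) * Var cz =
      (F - Const c * Var cz) - Const k * (G - Const d * Var cz)"
    by (simp add: Const_diff Const_mult algebra_simps)
  have "degree_le 4 (F - Const k * G)"
    using F G degree_le_diff[OF _ degree_le_mult[OF bounded_Const(1)], of 4 F 4 G k]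
    by (simp add: admissible_def)
  then show ?thesis
    using F G unfolding admissible_def shift
    by (simp add: pole_free_diff pole_free_mult pole_free_Const)
qed

lemma admissible_Ham: "admissible 1 (Ham \<alpha>1 \<alpha>2 \<alpha>3)"
  unfolding admissible_def
  using degree_le_Ham pole_free_Ham_0[OF sum_1] pole_free_Ham_1 pole_free_Ham_2 pole_free_Ham_3 by simp

lemma admissible_y_2p:
  assumes "k \<le> 4"
  shows "admissible 0 (y_2p ^ k)"
  unfolding admissible_def using bounded_mono(1)[OF degree_le_y_2p assms]
  by (simp add: pole_free_power pole_free_y_2p)

lemma leading_solution_weight_part:
  assumes "admissible c F" "weight_le n F"
  shows "leading_solution n (weight_part n F)"
proof -
  have "degree_le 4 (weight_part n F)" "\<forall>m\<in>Poly_Mapping.keys (weight_part n F). weight m = n"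
    using assms(1)
    by (auto simp: admissible_def degree_le_def in_keys_iff lookup_weight_part split: if_splits)
  moreover have pole_free: "pole_free cx cy (old0 (scal \<alpha>0)) F" "pole_free cz cw (old1 (scal \<alpha>1)) F"
      "pole_free cq cp (old3 (scal \<alpha>3)) F"
    using assms(1) by (simp_all add: admissible_def)
  ultimately show ?thesis
    unfolding leading_solution_def
    using leading_part_0[OF pole_free(1) assms(2)] leading_part_1[OF pole_free(2) assms(2)]
      leading_part_3[OF pole_free(3) assms(2)] by blast
qed

lemma invariant_2_weight_part:
  assumes "admissible c F" "weight_le n F" "2 \<le> n"
  shows "invariant_2 (weight_part n F)"
proof -
  have "weight_le n (F - Const c * Var cz)"
    using assms(2,3) weight_le_diff[OF assms(2) weight_le_mult[OF bounded_Const(2)[of c] bounded_Var(2)[of cz]]]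
    by (simp add: max_def)
  moreover have "weight_part n (F - Const c * Var cz) = weight_part n F"
    using assms(3) by (simp add: weight_part_diff weight_part_Const_mult weight_part_Var)
  ultimately show ?thesis
    using leading_part_2[of tvar "scal \<alpha>2" "F - Const c * Var cz" n] assms(1)
    unfolding invariant_2_def admissible_def by simp
qed

lemma weight_part_eqI:
  assumes "admissible c F" "weight_le n F" "degree_le 4 G"
    and "\<And>x y z w q p. at6 (weight_part n F) x y z w q p = at6 G x y z w q p"
  shows "weight_part n F = G"
proof -
  have "degree_le 4 (weight_part n F - G)"
    using degree_le_diff[of 4 "weight_part n F" 4 G] leading_solution_weight_part[OF assms(1,2)] assms(3)
    by (simp add: leading_solution_def)
  from eq_0_if_vanishing_everywhere[OF this] show ?thesis
    by (simp add: assms(4))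
qed

lemma reduce_odd:
  assumes F: "admissible c F" "weight_le n F" and n: "n = 3 \<or> n = 5 \<or> n = 7"
  shows "weight_le (n - 1) F"
proof -
  have "2 \<le> n" using n by auto
  note sol = leading_solution_weight_part[OF F] invariant_2_weight_part[OF F \<open>2 \<le> n\<close>]
  have "at6 (weight_part n F) x y z w q p = at6 0 x y z w q p" for x y z w q p
    using n sol leading_solution_3 leading_solution_5 leading_solution_7 by (elim disjE) simp_all
  from weight_part_eqI[OF F _ this] have "weight_part n F = 0"
    by (simp add: degree_le_def)
  then show ?thesis
    using weight_le_remove_part[OF F(2)] n by auto
qed

lemma reduce_even:
  assumes F: "admissible c F" "weight_le (2 * k) F" and k: "k = 1 \<or> k = 2 \<or> k = 4"
  shows "\<exists>e. admissible c (F - Const e * y_2p ^ k) \<and> weight_le (2 * k - 1) (F - Const e * y_2p ^ k)"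
proof -
  have "2 \<le> 2 * k" "k \<le> 4" using k by auto
  note sol = leading_solution_weight_part[OF F] invariant_2_weight_part[OF F \<open>2 \<le> 2 * k\<close>]
  have "\<exists>e. \<forall>x y z w q p. at6 (weight_part (2 * k) F) x y z w q p = e * (y + 2 * p) ^ k"
    using k sol leading_solution_2[of "weight_part (2 * k) F"] leading_solution_4[of "weight_part (2 * k) F"]
      leading_solution_8[of "weight_part (2 * k) F"] by (elim disjE) simp_all
  then obtain e where e: "\<And>x y z w q p. at6 (weight_part (2 * k) F) x y z w q p = e * (y + 2 * p) ^ k"
    by blast
  have "degree_le 4 (Const e * y_2p ^ k)"
    using degree_le_mult[OF bounded_Const(1) degree_le_y_2p] \<open>k \<le> 4\<close> bounded_mono(1) by fastforce
  then have "weight_part (2 * k) F = Const e * y_2p ^ k"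
    by (rule weight_part_eqI[OF F]) (simp add: e y_2p_def)
  then show ?thesis
    using weight_le_remove_part[OF F(2)] admissible_diff[OF F(1) admissible_y_2p[OF \<open>k \<le> 4\<close>], of e] k
    by auto
qed

text \<open>The Hamiltonian is subtracted as a multiple of tH, whose part of weight 6 is \<open>lead_Ham\<close>; the
  factor t is absorbed into s.\<close>
lemma reduce_6:
  assumes F: "admissible c F" "weight_le 6 F"
  shows "\<exists>e s. admissible (c - s) (F - Const e * y_2p ^ 3 - Const s * Ham \<alpha>1 \<alpha>2 \<alpha>3) \<and>
    weight_le 5 (F - Const e * y_2p ^ 3 - Const s * Ham \<alpha>1 \<alpha>2 \<alpha>3)"
proof -
  obtain e s where es: "\<And>x y z w q p. at6 (weight_part 6 F) x y z w q p =
      e * (y + 2 * p) ^ 3 + s * at6 lead_Ham x y z w q p"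
    using leading_solution_6[OF leading_solution_weight_part[OF F] invariant_2_weight_part[OF F]] by auto
  have "degree_le 4 (Const e * y_2p ^ 3 + Const s * lead_Ham)"
    by (rule bounded_mono, (rule degree_le_y_2p degree_le_lead_Ham degree_le_rules)+, simp)
  then have top: "weight_part 6 F = Const e * y_2p ^ 3 + Const s * lead_Ham"
    by (rule weight_part_eqI[OF F]) (simp add: es y_2p_def)
  let ?H = "Ham \<alpha>1 \<alpha>2 \<alpha>3"
  have "F - Const e * y_2p ^ 3 - Const (s * tvar) * ?H =
      (F - weight_part 6 F) - Const s * (Const tvar * ?H - lead_Ham)"
    by (rule poly_mapping_eqI) (simp add: top lookup_minus lookup_add lookup_Const_mult algebra_simps)
  moreover have "weight_le 5 \<dots>"
    using weight_le_diff[OF weight_le_remove_part[OF F(2)]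
        weight_le_mult[OF bounded_Const(2) Ham_lower_terms], of s] by simp
  moreover have "admissible (c - s * tvar) (F - Const e * y_2p ^ 3 - Const (s * tvar) * ?H)"
    using admissible_diff[OF admissible_diff[OF F(1) admissible_y_2p[of 3], of e] admissible_Ham, of "s * tvar"]
    by simp
  ultimately show ?thesis by metis
qed

text \<open>In weight 1 the term \<open>c z\<close> belongs to the leading part. The first two and the last coordinate change
  already exclude a linear form in x, z, q, so the third one reads \<open>c z = 0\<close>.\<close>
lemma reduce_1:
  assumes F: "admissible c F" "weight_le 1 F"
  shows "weight_le 0 F" "c = 0"
proof -
  have "at6 (weight_part 1 F) x y z w q p = at6 0 x y z w q p" for x y z w q p
    using leading_solution_1[OF leading_solution_weight_part[OF F]] by (simp only: ev_0)
  from weight_part_eqI[OF F _ this] have "weight_part 1 F = 0"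
    by (simp add: degree_le_def)
  then show "weight_le 0 F"
    using weight_le_remove_part[OF F(2)] by simp
  have "weight_le 1 (F - Const c * Var cz)"
    using weight_le_diff[OF F(2) weight_le_mult[OF bounded_Const(2)[of c] bounded_Var(2)[of cz]]] by simp
  moreover have "weight_part 1 (F - Const c * Var cz) = - (Const c * Var cz)"
    using \<open>weight_part 1 F = 0\<close>
    by (simp add: weight_part_diff weight_part_Const_mult weight_part_Var)
  ultimately show "c = 0"
    using leading_part_2[of tvar "scal \<alpha>2" "F - Const c * Var cz" 1 0 1 0 0 0] F(1)
    unfolding admissible_def by simp
qed

lemma admissible_1_classification:
  assumes K: "admissible 1 K"
  shows "\<exists>c a1 a2 a3 a4. K = Ham \<alpha>1 \<alpha>2 \<alpha>3 + Const a1 * y_2p + Const a2 * y_2p ^ 2 + Const a3 * y_2p ^ 3 + Const a4 * y_2p ^ 4 + Const c"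
proof -
  have "weight_le 8 K"
    unfolding weight_le_def
  proof
    fix m assume "m \<in> Poly_Mapping.keys K"
    then have "(\<Sum>v\<in>UNIV. Poly_Mapping.lookup m v) \<le> 4"
      using K by (simp add: admissible_def degree_le_def)
    then show "weight m \<le> 8"
      by (simp add: weight_def UNIV_coord)
  qed
  then obtain a4 where 7: "admissible 1 (K - Const a4 * y_2p ^ 4)" "weight_le 7 (K - Const a4 * y_2p ^ 4)"
    using reduce_even[OF K, of 4] by auto
  then have "weight_le 6 (K - Const a4 * y_2p ^ 4)"
    using reduce_odd[OF 7] by simp
  from reduce_6[OF 7(1) this] obtain a3 s where
    5: "admissible (1 - s) (K - Const a4 * y_2p ^ 4 - Const a3 * y_2p ^ 3 - Const s * Ham \<alpha>1 \<alpha>2 \<alpha>3)" (is "admissible _ ?F5")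
    "weight_le 5 (K - Const a4 * y_2p ^ 4 - Const a3 * y_2p ^ 3 - Const s * Ham \<alpha>1 \<alpha>2 \<alpha>3)"
    by blast
  then have "weight_le (2 * 2) ?F5"
    using reduce_odd[OF 5] by simp
  from reduce_even[OF 5(1) this] obtain a2 where
    3: "admissible (1 - s) (?F5 - Const a2 * y_2p ^ 2)" "weight_le 3 (?F5 - Const a2 * y_2p ^ 2)"
    by auto
  then have "weight_le (2 * 1) (?F5 - Const a2 * y_2p ^ 2)"
    using reduce_odd[OF 3] by simp
  from reduce_even[OF 3(1) this] obtain a1 where
    1: "admissible (1 - s) (?F5 - Const a2 * y_2p ^ 2 - Const a1 * y_2p)" (is "admissible _ ?F1")
      "weight_le 1 (?F5 - Const a2 * y_2p ^ 2 - Const a1 * y_2p)"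
    by auto
  have s: "Const s = 1"
    using reduce_1(2)[OF 1] by (simp add: Const_def)
  have "m = 0" if "weight m = 0" for m :: "coord \<Rightarrow>\<^sub>0 nat"
  proof (rule poly_mapping_eqI)
    show "Poly_Mapping.lookup m u = Poly_Mapping.lookup 0 u" for u
      using that by (cases u) (simp_all add: weight_def UNIV_coord)
  qed
  then have "Poly_Mapping.lookup ?F1 m = 0" if "m \<noteq> 0" for m
    using reduce_1(1)[OF 1] that unfolding weight_le_def by (metis in_keys_iff le_zero_eq)
  then have "?F1 = Const (Poly_Mapping.lookup ?F1 0)"
    unfolding Const_def by (intro poly_mapping_eqI) (simp add: lookup_single when_def)
  then have "K = Ham \<alpha>1 \<alpha>2 \<alpha>3 + Const a1 * y_2p + Const a2 * y_2p ^ 2 + Const a3 * y_2p ^ 3 + Const a4 * y_2p ^ 4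
      + Const (Poly_Mapping.lookup ?F1 0)"
    unfolding s by (simp add: algebra_simps)
  then show ?thesis by blast
qed

end

theorem theorem3p4:
  fixes \<alpha>\<^sub>0 \<alpha>\<^sub>1 \<alpha>\<^sub>2 \<alpha>\<^sub>3 :: complex and K :: mpoly
  assumes "\<alpha>\<^sub>0 + \<alpha>\<^sub>1 + \<alpha>\<^sub>2 + \<alpha>\<^sub>3 = 1"
    and "total_degree K = 4"
    and "is_polynomial (rewrite_in (r0 (rconst (scal \<alpha>\<^sub>0))) K)"
    and "is_polynomial (rewrite_in (r1 (rconst (scal \<alpha>\<^sub>1))) K)"
    and "is_polynomial (rewrite_in (r2 (rconst tvar) (rconst (scal \<alpha>\<^sub>2))) (K - Var cz))"
    and "is_polynomial (rewrite_in (r3 (rconst (scal \<alpha>\<^sub>3))) K)"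
  shows "\<exists>a\<^sub>1 a\<^sub>2 a\<^sub>3 a\<^sub>4 :: ct.
    hamiltonian_system K =
    hamiltonian_system (Ham \<alpha>\<^sub>1 \<alpha>\<^sub>2 \<alpha>\<^sub>3
      + Const a\<^sub>1 * (Var cy + 2 * Var cp) + Const a\<^sub>2 * (Var cy + 2 * Var cp) ^ 2
      + Const a\<^sub>3 * (Var cy + 2 * Var cp) ^ 3 + Const a\<^sub>4 * (Var cy + 2 * Var cp) ^ 4)"
proof -
  have "degree_le 4 K"
    unfolding degree_le_def
  proof
    fix m assume "m \<in> Poly_Mapping.keys K"
    then show "(\<Sum>v\<in>UNIV. Poly_Mapping.lookup m v) \<le> 4"
      unfolding assms(2)[symmetric] total_degree_def by (intro Max_ge) auto
  qed
  then have "admissible \<alpha>\<^sub>0 \<alpha>\<^sub>1 \<alpha>\<^sub>2 \<alpha>\<^sub>3 1 K"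
    unfolding admissible_def[OF assms(1)]
    using assms(3-6) by (simp add: pole_free_0 pole_free_1 pole_free_2 pole_free_3)
  from admissible_1_classification[OF assms(1) this] show ?thesis
    unfolding hamiltonian_system_eq_iff y_2p_def by blast
qed

end
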